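(* Let $\mathbf{Mat}_\bullet$ be the proto-exact category of pointed matroids and strong maps. Then $K_0(\mathbf{Mat}_\bullet)\simeq \mathbb Z\oplus\mathbb Z$.
   Context: A matroid $M$ on a finite ground set $E_M$ is given by its closure (flats) operator $\sigma$; flats are the sets $\sigma S$, and $\mathcal F(M)$ is the set of flats. $M|S$ is the matroid on $S$ with flats $\{A\cap S: A\in\mathcal F(M)\}$; $M/S$ is the matroid on $E_M\setminus S$ with flats $\{A\setminus S: S\subseteq A\in\mathcal F(M)\}$. A pointed matroid is a pair $(M,*_M)$ where $*_M\in E_M$ is a distinguished loop (an element of $\sigma\emptyset$). A strong map $f:M\to N$ of pointed matroids is a function $f:E_M\to E_N$ with $f( *_M)=*_N$ and $f^{-1}A\in\mathcal F(M)$ for all $A\in\mathcal F(N)$. The zero object is the pointed matroid with ground set $\{*\}$. The proto-exact structure on $\mathbf{Mat}_\bullet$: admissible monomorphisms $\mathfrak M$ are the strong maps factoring as an isomorphism $N\to M|S$ followed by the inclusion $M|S\hookrightarrow M$, for some $S\ni *_M$; admissible epimorphisms $\mathfrak E$ are the strong maps factoring as $M\twoheadrightarrow M/S$ (sending $S$ to $*_M$ and fixing $E_M\setminus S$, where $*_M\notin S$) followed by an isomorphism $M/S\to N$. An admissible short exact sequence $A\hookrightarrow B\twoheadrightarrow C$ is a square that is both Cartesian and co-Cartesian with top $A\to B$ and bottom $0\to C$ in $\mathfrak M$, and left $A\to 0$ and right $B\to C$ in $\mathfrak E$. The Grothendieck group $K_0(\mathcal E)$ of a proto-exact category $\mathcal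 E$ is the free group on the set $\mathrm{Iso}(\mathcal E)$ of isomorphism classes of objects modulo the relations $[B]=[A][C]$ for every admissible short exact sequence $A\hookrightarrow B\twoheadrightarrow C$. (It coincides with $\pi_1$ of the geometric realization of the Waldhausen $\mathcal S$-construction of $\mathcal E$, and for $\mathcal E=\mathbf{Mat}_\bullet$ it is abelian.) *)

theory Defs
  imports "HOL-Algebra.Elementary_Groups" "HOL-Library.FuncSet"
begin

section \<open>Categories with admissible monomorphisms and epimorphisms\<close>

text \<open>
  Hom-sets of different pairs of objects may overlap (for pointed matroids, arrows are bare
  functions), so composition takes the objects as arguments: for \<open>f : X \<rightarrow> Y\<close> and \<open>g : Y \<rightarrow> Z\<close>
  the composite \<open>g f\<close> is \<open>Comp C X Y Z g f\<close>.
\<close>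

record ('o, 'm) category_data =
  Obj :: "'o set"
  Hom :: "'o \<Rightarrow> 'o \<Rightarrow> 'm set"
  Id :: "'o \<Rightarrow> 'm"
  Comp :: "'o \<Rightarrow> 'o \<Rightarrow> 'o \<Rightarrow> 'm \<Rightarrow> 'm \<Rightarrow> 'm"

record ('o, 'm) proto_exact_data = "('o, 'm) category_data" +
  Adm_mono :: "'o \<Rightarrow> 'o \<Rightarrow> 'm set"
  Adm_epi :: "'o \<Rightarrow> 'o \<Rightarrow> 'm set"

locale category =
  fixes C :: "('o, 'm, 'z) category_data_scheme"
  assumes Id_in_Hom: "X \<in> Obj C \<Longrightarrow> Id C X \<in> Hom C X X"
    and Comp_in_Hom:
      "\<lbrakk>X \<in> Obj C; Y \<in> Obj C; Z \<in> Obj C; f \<in> Hom C X Y; g \<in> Hom C Y Z\<rbrakk>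
        \<Longrightarrow> Comp C X Y Z g f \<in> Hom C X Z"
    and Comp_Id_left:
      "\<lbrakk>X \<in> Obj C; Y \<in> Obj C; f \<in> Hom C X Y\<rbrakk> \<Longrightarrow> Comp C X Y Y (Id C Y) f = f"
    and Comp_Id_right:
      "\<lbrakk>X \<in> Obj C; Y \<in> Obj C; f \<in> Hom C X Y\<rbrakk> \<Longrightarrow> Comp C X X Y f (Id C X) = f"
    and Comp_assoc:
      "\<lbrakk>W \<in> Obj C; X \<in> Obj C; Y \<in> Obj C; Z \<in> Obj C;
        f \<in> Hom C W X; g \<in> Hom C X Y; h \<in> Hom C Y Z\<rbrakk>
        \<Longrightarrow> Comp C W X Z (Comp C X Y Z h g) f = Comp C W Y Z h (Comp C W X Y g f)"

definition is_isomorphism :: "('o, 'm, 'z) category_data_scheme \<Rightarrow> 'o \<Rightarrow> 'o \<Rightarrow> 'm \<Rightarrow> bool" where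
  "is_isomorphism C X Y f \<longleftrightarrow> f \<in> Hom C X Y \<and>
    (\<exists>g \<in> Hom C Y X. Comp C X Y X g f = Id C X \<and> Comp C Y X Y f g = Id C Y)"

definition iso_rel :: "('o, 'm, 'z) category_data_scheme \<Rightarrow> ('o \<times> 'o) set" where
  "iso_rel C = {(X, Y). X \<in> Obj C \<and> Y \<in> Obj C \<and> (\<exists>f. is_isomorphism C X Y f)}"

definition Iso_classes :: "('o, 'm, 'z) category_data_scheme \<Rightarrow> 'o set set" where
  "Iso_classes C = Obj C // iso_rel C"

definition iso_class :: "('o, 'm, 'z) category_data_scheme \<Rightarrow> 'o \<Rightarrow> 'o set" where
  "iso_class C X = iso_rel C `` {X}"

definition zero_object :: "('o, 'm, 'z) category_data_scheme \<Rightarrow> 'o \<Rightarrow> bool" where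
  "zero_object C Z \<longleftrightarrow> Z \<in> Obj C \<and>
    (\<forall>X \<in> Obj C. (\<exists>!f. f \<in> Hom C Z X) \<and> (\<exists>!f. f \<in> Hom C X Z))"

text \<open>
  In the following definitions the square is
  \<open>i : A \<rightarrow> B\<close> (top), \<open>p : A \<rightarrow> D\<close> (left), \<open>q : B \<rightarrow> E\<close> (right), \<open>j : D \<rightarrow> E\<close> (bottom).
\<close>

definition commutative_square ::
    "('o, 'm, 'z) category_data_scheme \<Rightarrow> 'o \<Rightarrow> 'o \<Rightarrow> 'o \<Rightarrow> 'o \<Rightarrow> 'm \<Rightarrow> 'm \<Rightarrow> 'm \<Rightarrow> 'm \<Rightarrow> bool" where
  "commutative_square C A B D E i p q j \<longleftrightarrow>
    A \<in> Obj C \<and> B \<in> Obj C \<and> D \<in> Obj C \<and> E \<in> Obj C \<and>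
    i \<in> Hom C A B \<and> p \<in> Hom C A D \<and> q \<in> Hom C B E \<and> j \<in> Hom C D E \<and>
    Comp C A B E q i = Comp C A D E j p"

definition cartesian_square ::
    "('o, 'm, 'z) category_data_scheme \<Rightarrow> 'o \<Rightarrow> 'o \<Rightarrow> 'o \<Rightarrow> 'o \<Rightarrow> 'm \<Rightarrow> 'm \<Rightarrow> 'm \<Rightarrow> 'm \<Rightarrow> bool" where
  "cartesian_square C A B D E i p q j \<longleftrightarrow> commutative_square C A B D E i p q j \<and>
    (\<forall>T \<in> Obj C. \<forall>u \<in> Hom C T B. \<forall>v \<in> Hom C T D. Comp C T B E q u = Comp C T D E j v \<longrightarrow>
      (\<exists>!w. w \<in> Hom C T A \<and> Comp C T A B i w = u \<and> Comp C T A D p w = v))"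

definition cocartesian_square ::
    "('o, 'm, 'z) category_data_scheme \<Rightarrow> 'o \<Rightarrow> 'o \<Rightarrow> 'o \<Rightarrow> 'o \<Rightarrow> 'm \<Rightarrow> 'm \<Rightarrow> 'm \<Rightarrow> 'm \<Rightarrow> bool" where
  "cocartesian_square C A B D E i p q j \<longleftrightarrow> commutative_square C A B D E i p q j \<and>
    (\<forall>T \<in> Obj C. \<forall>u \<in> Hom C B T. \<forall>v \<in> Hom C D T. Comp C A B T u i = Comp C A D T v p \<longrightarrow>
      (\<exists>!w. w \<in> Hom C E T \<and> Comp C B E T w q = u \<and> Comp C D E T w j = v))"

definition admissible_ses ::
    "('o, 'm, 'z) proto_exact_data_scheme \<Rightarrow> 'o \<Rightarrow> 'o \<Rightarrow> 'o \<Rightarrow> 'm \<Rightarrow> 'm \<Rightarrow> bool" where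
  "admissible_ses C X Y Z i q \<longleftrightarrow>
    i \<in> Adm_mono C X Y \<and> q \<in> Adm_epi C Y Z \<and>
    (\<exists>N p j. zero_object C N \<and> p \<in> Adm_epi C X N \<and> j \<in> Adm_mono C N Z \<and>
      cartesian_square C X Y N Z i p q j \<and> cocartesian_square C X Y N Z i p q j)"


section \<open>Groups given by generators and relations\<close>

text \<open>
  The free group on \<open>X\<close> consists of the reduced words over \<open>X\<close>; the letter \<open>(x, True)\<close> stands
  for \<open>x\<close> and \<open>(x, False)\<close> for its inverse.
\<close>

definition inv_letter :: "'x \<times> bool \<Rightarrow> 'x \<times> bool" where
  "inv_letter a = (fst a, \<not> snd a)"

definition reduced :: "('x \<times> bool) list \<Rightarrow> bool" where
  "reduced w \<longleftrightarrow> successively (\<lambda>a b. b \<noteq> inv_letter a) w"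

fun push_letter :: "'x \<times> bool \<Rightarrow> ('x \<times> bool) list \<Rightarrow> ('x \<times> bool) list" where
  "push_letter a [] = [a]"
| "push_letter a (b # w) = (if b = inv_letter a then w else a # b # w)"

definition free_group :: "'x set \<Rightarrow> ('x \<times> bool) list monoid" where
  "free_group X = \<lparr>carrier = {w. set w \<subseteq> X \<times> UNIV \<and> reduced w},
     mult = (\<lambda>u v. foldr push_letter u v), one = []\<rparr>"

definition free_gen :: "'x \<Rightarrow> ('x \<times> bool) list" where
  "free_gen x = [(x, True)]"

definition normal_closure :: "('g, 'z) monoid_scheme \<Rightarrow> 'g set \<Rightarrow> 'g set" where
  "normal_closure G R = \<Inter> {N. N \<lhd> G \<and> R \<subseteq> N}"

lemma inv_letter_inv_letter [simp]: "inv_letter (inv_letter a) = a"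
  by (simp add: inv_letter_def)

lemma inv_letter_eq_iff: "a = inv_letter b \<longleftrightarrow> b = inv_letter a"
  by auto

lemma inv_letter_neq [simp]: "inv_letter a \<noteq> a"
  by (cases a) (simp add: inv_letter_def)

lemma reduced_Nil [simp]: "reduced []"
  by (simp add: reduced_def)

lemma reduced_tl: "reduced (a # w) \<Longrightarrow> reduced w"
  by (cases w) (auto simp: reduced_def)

lemma reduced_push: "reduced w \<Longrightarrow> reduced (push_letter a w)"
  by (cases w) (auto simp: reduced_def successively_Cons split: if_splits)

lemma reduced_foldr: "reduced v \<Longrightarrow> reduced (foldr push_letter u v)"
  by (induction u) (auto intro: reduced_push)

lemma set_push: "set (push_letter a w) \<subseteq> insert a (set w)"
  by (cases w) auto

lemma set_foldr: "set (foldr push_letter u v) \<subseteq> set u \<union> set v"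
proof (induction u)
  case (Cons a u)
  then show ?case using set_push[of a "foldr push_letter u v"] by auto
qed auto

lemma push_inv: "reduced w \<Longrightarrow> push_letter a (push_letter (inv_letter a) w) = w"
proof (cases w)
  case (Cons b w')
  assume r: "reduced w"
  show ?thesis
  proof (cases "b = a")
    case True
    then show ?thesis using Cons r by (cases w') (auto simp: reduced_def)
  qed (use Cons in auto)
qed auto

lemma foldr_push:
  assumes "reduced w"
  shows "foldr push_letter (push_letter a v) w = push_letter a (foldr push_letter v w)"
proof (cases v)
  case (Cons b v')
  then show ?thesis
    using push_inv[of "foldr push_letter v' w" a] reduced_foldr[OF assms, of v'] by auto
qed auto

lemma foldr_assoc:
  assumes "reduced w"
  shows "foldr push_letter (foldr push_letter u v) w = foldr push_letter u (foldr push_letter v w)"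
  by (induction u) (auto simp: foldr_push[OF assms])

lemma foldr_reduced_Nil: "reduced w \<Longrightarrow> foldr push_letter w [] = w"
proof (induction w)
  case (Cons a w)
  then have "foldr push_letter w [] = w" using reduced_tl by blast
  then show ?case using Cons.prems by (cases w) (auto simp: reduced_def)
qed auto

lemma foldr_rev_inv:
  assumes "reduced v"
  shows "foldr push_letter (map inv_letter (rev u)) (foldr push_letter u v) = v"
  using assms
proof (induction u arbitrary: v)
  case (Cons a u)
  have "push_letter (inv_letter a) (push_letter a (foldr push_letter u v)) = foldr push_letter u v"
    using push_inv[of "foldr push_letter u v" "inv_letter a"] reduced_foldr[OF Cons.prems] by simp
  then show ?case using Cons by simp
qed auto

lemma group_free_group: "group (free_group X)"
proof (rule groupI)
  fix u v w
  assume "u \<in> carrier (free_group X)" "v \<in> carrier (free_group X)" "w \<in> carrier (free_group X)"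
  then show "u \<otimes>\<^bsub>free_group X\<^esub> v \<otimes>\<^bsub>free_group X\<^esub> w =
      u \<otimes>\<^bsub>free_group X\<^esub> (v \<otimes>\<^bsub>free_group X\<^esub> w)"
    by (simp add: free_group_def foldr_assoc)
next
  fix u v assume "u \<in> carrier (free_group X)" "v \<in> carrier (free_group X)"
  then show "u \<otimes>\<^bsub>free_group X\<^esub> v \<in> carrier (free_group X)"
    using set_foldr[of u v] by (auto simp: free_group_def reduced_foldr)
next
  fix u assume u: "u \<in> carrier (free_group X)"
  let ?v = "foldr push_letter (map inv_letter (rev u)) []"
  have "?v \<in> carrier (free_group X)"
    using u set_foldr[of "map inv_letter (rev u)" "[]"] reduced_foldr[OF reduced_Nil]
    by (fastforce simp: free_group_def inv_letter_def)
  moreover have "?v \<otimes>\<^bsub>free_group X\<^esub> u = \<one>\<^bsub>free_group X\<^esub>"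
  proof -
    have "foldr push_letter ?v u = foldr push_letter (map inv_letter (rev u)) u"
      using u foldr_assoc[of u "map inv_letter (rev u)" "[]"] by (simp add: free_group_def)
    also have "\<dots> = []"
      using u foldr_rev_inv[of "[]" u] foldr_reduced_Nil[of u] by (simp add: free_group_def)
    finally show ?thesis by (simp add: free_group_def)
  qed
  ultimately show "\<exists>v\<in>carrier (free_group X). v \<otimes>\<^bsub>free_group X\<^esub> u = \<one>\<^bsub>free_group X\<^esub>"
    by blast
qed (auto simp: free_group_def)

lemma free_gen_in_carrier: "x \<in> X \<Longrightarrow> free_gen x \<in> carrier (free_group X)"
  by (simp add: free_gen_def free_group_def reduced_def)

lemma (in group) carrier_normal: "carrier G \<lhd> G"
  by (rule normalI) (use is_group subgroup_self in \<open>auto simp: r_coset_def l_coset_def, (metis inv_closed inv_solve_left' m_closed inv_solve_right m_assoc)+\<close>)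

lemma (in group) normal_closure_normal:
  assumes "R \<subseteq> carrier G"
  shows "normal_closure G R \<lhd> G" "R \<subseteq> normal_closure G R"
proof -
  let ?A = "{N. N \<lhd> G \<and> R \<subseteq> N}"
  have ne: "?A \<noteq> {}" using carrier_normal assms by blast
  have sub: "subgroup (\<Inter>?A) G"
    by (rule subgroups_Inter) (use ne in \<open>auto simp: normal_imp_subgroup\<close>)
  show "normal_closure G R \<lhd> G"
    unfolding normal_closure_def normal_inv_iff
    using sub by (auto simp: normal_inv_iff)
  show "R \<subseteq> normal_closure G R" by (auto simp: normal_closure_def)
qed


section \<open>The Grothendieck group\<close>

definition K0_relators :: "('o, 'm, 'z) proto_exact_data_scheme \<Rightarrow> ('o set \<times> bool) list set" where
  "K0_relators C = (let F = free_group (Iso_classes C); g = (\<lambda>X. free_gen (iso_class C X)) in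
    {g B \<otimes>\<^bsub>F\<^esub> inv\<^bsub>F\<^esub> (g A \<otimes>\<^bsub>F\<^esub> g D) | A B D i q. admissible_ses C A B D i q})"

definition K0 :: "('o, 'm, 'z) proto_exact_data_scheme \<Rightarrow> ('o set \<times> bool) list set monoid" where
  "K0 C = (let F = free_group (Iso_classes C) in F Mod normal_closure F (K0_relators C))"

lemma iso_class_in: "X \<in> Obj C \<Longrightarrow> iso_class C X \<in> Iso_classes C"
  by (simp add: iso_class_def Iso_classes_def quotientI)

lemma admissible_ses_Obj:
  "admissible_ses C A B D i q \<Longrightarrow> A \<in> Obj C \<and> B \<in> Obj C \<and> D \<in> Obj C"
  by (auto simp: admissible_ses_def cartesian_square_def commutative_square_def)

lemma K0_relators_subset: "K0_relators C \<subseteq> carrier (free_group (Iso_classes C))"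
proof -
  interpret F: group "free_group (Iso_classes C)" by (rule group_free_group)
  show ?thesis
    by (auto simp: K0_relators_def Let_def dest!: admissible_ses_Obj
        intro!: F.m_closed F.inv_closed free_gen_in_carrier iso_class_in)
qed

lemma group_K0: "group (K0 C)"
proof -
  interpret F: group "free_group (Iso_classes C)" by (rule group_free_group)
  show ?thesis
    using F.normal_closure_normal(1)[OF K0_relators_subset]
    by (simp add: K0_def Let_def normal.factorgroup_is_group)
qed


section \<open>Pointed matroids and strong maps\<close>

record 'a pmatroid =
  ground :: "'a set"
  cl :: "'a set \<Rightarrow> 'a set"
  pt :: 'a

text \<open>
  The closure operator is required to be \<^const>\<open>undefined\<close> outside the power set of the ground
  set, so that a matroid is determined by its ground set and its flats.
\<close>

definition matroid :: "'a set \<Rightarrow> ('a set \<Rightarrow> 'a set) \<Rightarrow> bool" where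
  "matroid E \<sigma> \<longleftrightarrow> finite E \<and> \<sigma> \<in> Pow E \<rightarrow>\<^sub>E Pow E \<and>
    (\<forall>X \<subseteq> E. X \<subseteq> \<sigma> X) \<and>
    (\<forall>X Y. X \<subseteq> Y \<and> Y \<subseteq> E \<longrightarrow> \<sigma> X \<subseteq> \<sigma> Y) \<and>
    (\<forall>X \<subseteq> E. \<sigma> (\<sigma> X) = \<sigma> X) \<and>
    (\<forall>X \<subseteq> E. \<forall>x \<in> E. \<forall>y \<in> E. y \<in> \<sigma> (insert x X) - \<sigma> X \<longrightarrow> x \<in> \<sigma> (insert y X))"

definition pointed_matroid :: "'a pmatroid \<Rightarrow> bool" where
  "pointed_matroid M \<longleftrightarrow> matroid (ground M) (cl M) \<and> pt M \<in> ground M \<and> pt M \<in> cl M {}"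

definition flats :: "'a pmatroid \<Rightarrow> 'a set set" where
  "flats M = cl M ` Pow (ground M)"

definition closure_of_flats :: "'a set \<Rightarrow> 'a set set \<Rightarrow> 'a set \<Rightarrow> 'a set" where
  "closure_of_flats E F = (\<lambda>X \<in> Pow E. \<Inter> {A \<in> F. X \<subseteq> A})"

definition restriction :: "'a pmatroid \<Rightarrow> 'a set \<Rightarrow> 'a pmatroid" where
  "restriction M S =
    \<lparr>ground = S, cl = closure_of_flats S {A \<inter> S | A. A \<in> flats M}, pt = pt M\<rparr>"

definition contraction :: "'a pmatroid \<Rightarrow> 'a set \<Rightarrow> 'a pmatroid" where
  "contraction M S =
    \<lparr>ground = ground M - S,
     cl = closure_of_flats (ground M - S) {A - S | A. A \<in> flats M \<and> S \<subseteq> A}, pt = pt M\<rparr>"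

definition strong_maps :: "'a pmatroid \<Rightarrow> 'a pmatroid \<Rightarrow> ('a \<Rightarrow> 'a) set" where
  "strong_maps M N = {f \<in> ground M \<rightarrow>\<^sub>E ground N. f (pt M) = pt N \<and>
    (\<forall>A \<in> flats N. f -` A \<inter> ground M \<in> flats M)}"

definition Mat_category :: "('a pmatroid, 'a \<Rightarrow> 'a) category_data" where
  "Mat_category = \<lparr>Obj = {M. pointed_matroid M}, Hom = strong_maps,
     Id = (\<lambda>M. \<lambda>x \<in> ground M. x), Comp = (\<lambda>M N P g f. compose (ground M) g f)\<rparr>"

definition restriction_incl :: "'a set \<Rightarrow> 'a \<Rightarrow> 'a" where
  "restriction_incl S = (\<lambda>x \<in> S. x)"

definition contraction_proj :: "'a pmatroid \<Rightarrow> 'a set \<Rightarrow> 'a \<Rightarrow> 'a" where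
  "contraction_proj M S = (\<lambda>x \<in> ground M. if x \<in> S then pt M else x)"

definition Mat_monos :: "'a pmatroid \<Rightarrow> 'a pmatroid \<Rightarrow> ('a \<Rightarrow> 'a) set" where
  "Mat_monos N M = {f \<in> strong_maps N M. \<exists>S g. pt M \<in> S \<and> S \<subseteq> ground M \<and>
    is_isomorphism Mat_category N (restriction M S) g \<and>
    f = Comp Mat_category N (restriction M S) M (restriction_incl S) g}"

definition Mat_epis :: "'a pmatroid \<Rightarrow> 'a pmatroid \<Rightarrow> ('a \<Rightarrow> 'a) set" where
  "Mat_epis M N = {f \<in> strong_maps M N. \<exists>S g. pt M \<notin> S \<and> S \<subseteq> ground M \<and>
    is_isomorphism Mat_category (contraction M S) N g \<and>
    f = Comp Mat_category M (contraction M S) N g (contraction_proj M S)}"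

text \<open>
  Ground sets are finite subsets of the type \<open>'a\<close>. If \<open>'a\<close> is infinite, every pointed matroid on a
  finite set has an isomorphic copy here; on a finite type the category is truncated.
\<close>

definition Mat :: "('a pmatroid, 'a \<Rightarrow> 'a) proto_exact_data" where
  "Mat = category_data.extend Mat_category \<lparr>Adm_mono = Mat_monos, Adm_epi = Mat_epis\<rparr>"


subsection \<open>Consistency of the definitions\<close>

lemma matroid_facts:
  assumes "matroid E \<sigma>"
  shows matroid_finite: "finite E"
    and matroid_fun: "\<sigma> \<in> Pow E \<rightarrow>\<^sub>E Pow E"
    and matroid_closed: "X \<subseteq> E \<Longrightarrow> \<sigma> X \<subseteq> E"
    and matroid_extensive: "X \<subseteq> E \<Longrightarrow> X \<subseteq> \<sigma> X"
    and matroid_mono: "\<lbrakk>X \<subseteq> Y; Y \<subseteq> E\<rbrakk> \<Longrightarrow> \<sigma> X \<subseteq> \<sigma> Y"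
    and matroid_idem: "X \<subseteq> E \<Longrightarrow> \<sigma> (\<sigma> X) = \<sigma> X"
    and matroid_exchange:
      "\<lbrakk>X \<subseteq> E; x \<in> E; y \<in> E; y \<in> \<sigma> (insert x X); y \<notin> \<sigma> X\<rbrakk> \<Longrightarrow> x \<in> \<sigma> (insert y X)"
proof -
  show "\<sigma> \<in> Pow E \<rightarrow>\<^sub>E Pow E" using assms by (simp add: matroid_def)
  then show "\<sigma> X \<subseteq> E" if "X \<subseteq> E" using that by (meson PowD PowI PiE_mem)
qed (use assms in \<open>simp_all add: matroid_def\<close>)

lemma matroidI:
  assumes "finite E" "\<sigma> \<in> extensional (Pow E)"
    and "\<And>X. X \<subseteq> E \<Longrightarrow> \<sigma> X \<subseteq> E"
    and "\<And>X. X \<subseteq> E \<Longrightarrow> X \<subseteq> \<sigma> X"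
    and "\<And>X Y. \<lbrakk>X \<subseteq> Y; Y \<subseteq> E\<rbrakk> \<Longrightarrow> \<sigma> X \<subseteq> \<sigma> Y"
    and "\<And>X. X \<subseteq> E \<Longrightarrow> \<sigma> (\<sigma> X) \<subseteq> \<sigma> X"
    and "\<And>X x y. \<lbrakk>X \<subseteq> E; x \<in> E; y \<in> E; y \<in> \<sigma> (insert x X); y \<notin> \<sigma> X\<rbrakk> \<Longrightarrow> x \<in> \<sigma> (insert y X)"
  shows "matroid E \<sigma>"
proof -
  have "\<sigma> (\<sigma> X) = \<sigma> X" if "X \<subseteq> E" for X
    using assms(3,4,6) that by (simp add: subset_antisym)
  moreover have "\<sigma> \<in> Pow E \<rightarrow>\<^sub>E Pow E"
    using assms(2,3) by (simp add: PiE_def Pi_def)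
  ultimately show ?thesis
    using assms(1,4,5,7) by (simp add: matroid_def)
qed

lemma flats_iff:
  assumes "pointed_matroid M"
  shows "A \<in> flats M \<longleftrightarrow> A \<subseteq> ground M \<and> cl M A = A"
  using assms unfolding pointed_matroid_def flats_def
  by (smt (verit, best) Pow_iff image_iff matroid_closed matroid_idem)

lemma ground_in_flats: "pointed_matroid M \<Longrightarrow> ground M \<in> flats M"
  by (meson flats_iff matroid_closed matroid_extensive order_refl pointed_matroid_def subset_antisym)

lemma pt_in_flat: "\<lbrakk>pointed_matroid M; A \<in> flats M\<rbrakk> \<Longrightarrow> pt M \<in> A"
  by (metis flats_iff matroid_mono empty_subsetI pointed_matroid_def subsetD)

lemma pmatroid_eqI:
  assumes "pointed_matroid M" "pointed_matroid N"
    and "ground M = ground N" "flats M = flats N" "pt M = pt N"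
  shows "M = N"
proof -
  have *: "cl M X \<subseteq> cl N X"
    if "pointed_matroid M" "pointed_matroid N" "ground M = ground N" "flats M = flats N"
      "X \<subseteq> ground M" for X and M N :: "'a pmatroid"
  proof -
    have N: "matroid (ground N) (cl N)" and M: "matroid (ground M) (cl M)"
      using that by (auto simp: pointed_matroid_def)
    have "cl N X \<in> flats M" using that by (auto simp: flats_def)
    then have "cl M (cl N X) = cl N X" "cl N X \<subseteq> ground M" using that(1) flats_iff by auto
    then show ?thesis
      using matroid_mono[OF M, of X "cl N X"] matroid_extensive[OF N, of X] that by auto
  qed
  have "cl M X = cl N X" if "X \<subseteq> ground M" for X
    using *[of M N X] *[of N M X] that assms by auto
  moreover have "cl M \<in> extensional (Pow (ground M))" "cl N \<in> extensional (Pow (ground M))"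
    using assms by (auto simp: pointed_matroid_def matroid_def PiE_def)
  ultimately have "cl M = cl N" by (auto intro: extensionalityI)
  then show ?thesis using assms by simp
qed

lemma cl_restriction:
  assumes M: "pointed_matroid M" and S: "S \<subseteq> ground M" and X: "X \<subseteq> S"
  shows "cl (restriction M S) X = cl M X \<inter> S"
proof -
  have m: "matroid (ground M) (cl M)" using M by (simp add: pointed_matroid_def)
  have "cl M X \<subseteq> A" if "A \<in> flats M" "X \<subseteq> A" for A
    using that flats_iff[OF M] matroid_mono[OF m, of X A] by auto
  moreover have "cl M X \<in> flats M" "X \<subseteq> cl M X"
    using S X matroid_extensive[OF m, of X] by (auto simp: flats_def)
  ultimately have "\<Inter> {B \<in> {A \<inter> S | A. A \<in> flats M}. X \<subseteq> B} = cl M X \<inter> S"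
    using X by (intro equalityI Inter_lower Inter_greatest) (blast+)
  then show ?thesis using X by (simp add: restriction_def closure_of_flats_def)
qed

lemma cl_contraction:
  assumes M: "pointed_matroid M" and S: "S \<subseteq> ground M" and X: "X \<subseteq> ground M - S"
  shows "cl (contraction M S) X = cl M (X \<union> S) - S"
proof -
  have m: "matroid (ground M) (cl M)" using M by (simp add: pointed_matroid_def)
  have "cl M (X \<union> S) \<subseteq> A" if "A \<in> flats M" "X \<subseteq> A" "S \<subseteq> A" for A
    using that flats_iff[OF M] matroid_mono[OF m, of "X \<union> S" A] by auto
  moreover have "cl M (X \<union> S) \<in> flats M" "X \<union> S \<subseteq> cl M (X \<union> S)"
    using S X matroid_extensive[OF m, of "X \<union> S"] by (auto simp: flats_def)
  ultimately have "\<Inter> {B \<in> {A - S | A. A \<in> flats M \<and> S \<subseteq> A}. X \<subseteq> B} = cl M (X \<union> S) - S"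
    using X by (intro equalityI Inter_lower Inter_greatest) (blast+)
  then show ?thesis using X by (simp add: contraction_def closure_of_flats_def)
qed

lemma ground_restriction [simp]: "ground (restriction M S) = S"
  and pt_restriction [simp]: "pt (restriction M S) = pt M"
  and ground_contraction [simp]: "ground (contraction M S) = ground M - S"
  and pt_contraction [simp]: "pt (contraction M S) = pt M"
  by (simp_all add: restriction_def contraction_def)

lemma pointed_matroid_restriction:
  assumes M: "pointed_matroid M" and S: "S \<subseteq> ground M" "pt M \<in> S"
  shows "pointed_matroid (restriction M S)"
proof -
  have m: "matroid (ground M) (cl M)" using M by (simp add: pointed_matroid_def)
  note c = cl_restriction[OF M S(1)]
  have "matroid S (cl (restriction M S))"
  proof (rule matroidI)
    show "finite S" using m S finite_subset matroid_finite by blast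
    show "cl (restriction M S) \<in> extensional (Pow S)"
      by (simp add: restriction_def closure_of_flats_def)
  next
    fix X assume X: "X \<subseteq> S"
    show "cl (restriction M S) X \<subseteq> S" using X c[OF X] by simp
    show "X \<subseteq> cl (restriction M S) X"
      using X S c[OF X] matroid_extensive[OF m, of X] by auto
    show "cl (restriction M S) (cl (restriction M S) X) \<subseteq> cl (restriction M S) X"
      using X S c[OF X] c[of "cl M X \<inter> S"] matroid_idem[OF m, of X] matroid_closed[OF m, of X]
        matroid_mono[OF m, of "cl M X \<inter> S" "cl M X"] by auto
  next
    fix X Y assume "X \<subseteq> Y" "Y \<subseteq> S"
    moreover from this have "X \<subseteq> S" "cl M X \<subseteq> cl M Y"
      using matroid_mono[OF m, of X Y] S by auto
    ultimately show "cl (restriction M S) X \<subseteq> cl (restriction M S) Y"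
      using c[of X] c[of Y] by auto
  next
    fix X x y assume *: "X \<subseteq> S" "x \<in> S" "y \<in> S"
      "y \<in> cl (restriction M S) (insert x X)" "y \<notin> cl (restriction M S) X"
    then show "x \<in> cl (restriction M S) (insert y X)"
      using matroid_exchange[OF m, of X x y] S c[of "insert x X"] c[of "insert y X"] c[of X] by auto
  qed
  then show ?thesis using M S c[of "{}"] by (auto simp: pointed_matroid_def)
qed

lemma flats_restriction:
  assumes M: "pointed_matroid M" and S: "S \<subseteq> ground M"
  shows "flats (restriction M S) = {A \<inter> S | A. A \<in> flats M}"
proof -
  have m: "matroid (ground M) (cl M)" using M by (simp add: pointed_matroid_def)
  have "A \<inter> S \<in> flats (restriction M S)" if A: "A \<in> flats M" for A
  proof -
    have "cl M (A \<inter> S) \<subseteq> A" "A \<inter> S \<subseteq> cl M (A \<inter> S)"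
      using A S flats_iff[OF M] matroid_mono[OF m, of "A \<inter> S" A] matroid_extensive[OF m, of "A \<inter> S"]
      by auto
    then have "cl M (A \<inter> S) \<inter> S = A \<inter> S" by auto
    then have "A \<inter> S = cl (restriction M S) (A \<inter> S)"
      using cl_restriction[OF M S, of "A \<inter> S"] by simp
    then show ?thesis unfolding flats_def by auto
  qed
  moreover have "\<exists>A. B = A \<inter> S \<and> A \<in> flats M" if B: "B \<in> flats (restriction M S)" for B
  proof -
    obtain X where "X \<subseteq> S" "B = cl (restriction M S) X" using B by (auto simp: flats_def)
    then have "B = cl M X \<inter> S" "cl M X \<in> flats M"
      using S cl_restriction[OF M S, of X] by (auto simp: flats_def)
    then show ?thesis by blast
  qed
  ultimately show ?thesis by blast
qed

lemma pointed_matroid_contraction: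
  assumes M: "pointed_matroid M" and S: "S \<subseteq> ground M" "pt M \<notin> S"
  shows "pointed_matroid (contraction M S)"
proof -
  have m: "matroid (ground M) (cl M)" using M by (simp add: pointed_matroid_def)
  note c = cl_contraction[OF M S(1)]
  have "matroid (ground M - S) (cl (contraction M S))"
  proof (rule matroidI)
    show "finite (ground M - S)" using m matroid_finite by blast
    show "cl (contraction M S) \<in> extensional (Pow (ground M - S))"
      by (simp add: contraction_def closure_of_flats_def)
  next
    fix X assume X: "X \<subseteq> ground M - S"
    show "cl (contraction M S) X \<subseteq> ground M - S"
      unfolding c[OF X] using X S matroid_closed[OF m, of "X \<union> S"] by blast
    show "X \<subseteq> cl (contraction M S) X"
      unfolding c[OF X] using X S matroid_extensive[OF m, of "X \<union> S"] by blast
    have "cl M (X \<union> S) - S \<union> S = cl M (X \<union> S)" "cl M (X \<union> S) - S \<subseteq> ground M - S"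
      using X S matroid_extensive[OF m, of "X \<union> S"] matroid_closed[OF m, of "X \<union> S"] by blast+
    moreover have "cl M (cl M (X \<union> S)) = cl M (X \<union> S)"
      using X S matroid_idem[OF m, of "X \<union> S"] by blast
    ultimately show "cl (contraction M S) (cl (contraction M S) X) \<subseteq> cl (contraction M S) X"
      using c[OF X] c[of "cl M (X \<union> S) - S"] by simp
  next
    fix X Y assume "X \<subseteq> Y" "Y \<subseteq> ground M - S"
    moreover from this have "X \<union> S \<subseteq> Y \<union> S" "Y \<union> S \<subseteq> ground M" using S by blast+
    then have "cl M (X \<union> S) \<subseteq> cl M (Y \<union> S)" by (rule matroid_mono[OF m])
    ultimately show "cl (contraction M S) X \<subseteq> cl (contraction M S) Y"
      using c[of X] c[of Y] by (simp add: Diff_mono subset_trans[of X Y])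
  next
    fix X x y assume *: "X \<subseteq> ground M - S" "x \<in> ground M - S" "y \<in> ground M - S"
      "y \<in> cl (contraction M S) (insert x X)" "y \<notin> cl (contraction M S) X"
    then have "y \<in> cl M (insert x (X \<union> S))" "y \<notin> cl M (X \<union> S)"
      using c[of "insert x X"] c[of X] by auto
    then have "x \<in> cl M (insert y (X \<union> S))"
      using matroid_exchange[OF m, of "X \<union> S" x y] * S by blast
    then show "x \<in> cl (contraction M S) (insert y X)"
      using c[of "insert y X"] * by simp
  qed
  moreover have "pt M \<in> cl M S"
    using M S matroid_mono[OF m, of "{}" S] by (auto simp: pointed_matroid_def)
  ultimately show ?thesis using M S c[of "{}"] by (auto simp: pointed_matroid_def)
qed

lemma flats_contraction:
  assumes M: "pointed_matroid M" and S: "S \<subseteq> ground M"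
  shows "flats (contraction M S) = {A - S | A. A \<in> flats M \<and> S \<subseteq> A}"
proof -
  have m: "matroid (ground M) (cl M)" using M by (simp add: pointed_matroid_def)
  have "A - S \<in> flats (contraction M S)" if A: "A \<in> flats M" "S \<subseteq> A" for A
  proof -
    have "A - S \<union> S = A" using A by auto
    then have "A - S = cl (contraction M S) (A - S)"
      using A flats_iff[OF M] cl_contraction[OF M S, of "A - S"] by auto
    moreover have "A - S \<subseteq> ground M - S" using A flats_iff[OF M] by auto
    ultimately show ?thesis unfolding flats_def by auto
  qed
  moreover have "\<exists>A. B = A - S \<and> A \<in> flats M \<and> S \<subseteq> A" if B: "B \<in> flats (contraction M S)" for B
  proof -
    obtain X where "X \<subseteq> ground M - S" "B = cl (contraction M S) X"
      using B by (auto simp: flats_def)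
    then have X: "X \<subseteq> ground M - S" "B = cl M (X \<union> S) - S"
      using cl_contraction[OF M S, of X] by simp_all
    have "cl M (X \<union> S) \<in> flats M" "S \<subseteq> cl M (X \<union> S)"
      using X S matroid_extensive[OF m, of "X \<union> S"] by (auto simp: flats_def)
    then show ?thesis using X(2) by blast
  qed
  ultimately show ?thesis by blast
qed

lemma strong_maps_id: "pointed_matroid M \<Longrightarrow> (\<lambda>x \<in> ground M. x) \<in> strong_maps M M"
proof -
  assume M: "pointed_matroid M"
  have "(\<lambda>x \<in> ground M. x) -` A \<inter> ground M = A" if "A \<in> flats M" for A
    using that flats_iff[OF M] by auto
  then show ?thesis using M by (auto simp: strong_maps_def pointed_matroid_def)
qed

lemma strong_maps_compose:
  assumes "pointed_matroid M" and f: "f \<in> strong_maps M N" and g: "g \<in> strong_maps N P"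
  shows "compose (ground M) g f \<in> strong_maps M P"
proof -
  have "compose (ground M) g f -` A \<inter> ground M \<in> flats M" if "A \<in> flats P" for A
  proof -
    have "compose (ground M) g f -` A \<inter> ground M = f -` (g -` A \<inter> ground N) \<inter> ground M"
      using f by (auto simp: strong_maps_def compose_def)
    also have "\<dots> \<in> flats M" using f g that unfolding strong_maps_def by blast
    finally show ?thesis .
  qed
  then show ?thesis
    using assms by (auto simp: strong_maps_def pointed_matroid_def compose_def)
qed

lemma Mat_sel [simp]:
  "Obj Mat = {M. pointed_matroid M}" "Hom Mat = strong_maps"
  "Id Mat = (\<lambda>M. \<lambda>x \<in> ground M. x)" "Comp Mat = (\<lambda>M N P g f. compose (ground M) g f)"
  "Adm_mono Mat = Mat_monos" "Adm_epi Mat = Mat_epis"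
  by (simp_all add: Mat_def Mat_category_def category_data.defs)

lemma category_Mat: "category Mat"
proof
  fix X Y :: "'a pmatroid" and f
  assume X: "X \<in> Obj Mat" and Y: "Y \<in> Obj Mat" and f: "f \<in> Hom Mat X Y"
  show "Comp Mat X Y Y (Id Mat Y) f = f" "Comp Mat X X Y f (Id Mat X) = f"
    using f Id_compose[of f "ground X" "ground Y"] compose_Id[of f "ground X" "ground Y"]
    by (auto simp: strong_maps_def PiE_def)
next
  fix W X Y Z :: "'a pmatroid" and f g h
  assume "f \<in> Hom Mat W X"
  then have "f \<in> ground W \<rightarrow> ground X" by (auto simp: strong_maps_def)
  then show "Comp Mat W X Z (Comp Mat X Y Z h g) f = Comp Mat W Y Z h (Comp Mat W X Y g f)"
    by (simp add: compose_assoc[of f "ground W" "ground X"])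
qed (auto simp: strong_maps_id strong_maps_compose)

lemma singleton_pmatroid:
  fixes M :: "'a pmatroid"
  assumes M: "pointed_matroid M" and g: "ground M = {pt M}"
  shows "flats M = {{pt M}}"
proof
  show "flats M \<subseteq> {{pt M}}"
    using pt_in_flat[OF M] flats_iff[OF M] g by auto
  show "{{pt M}} \<subseteq> flats M" using ground_in_flats[OF M] g by simp
qed

lemma strong_maps_eqI:
  assumes "f \<in> strong_maps M N" "g \<in> strong_maps M N" "\<And>x. x \<in> ground M \<Longrightarrow> f x = g x"
  shows "f = g"
  by (rule PiE_ext[of f "ground M" "\<lambda>_. ground N" g]) (use assms in \<open>simp_all add: strong_maps_def\<close>)

lemma strong_maps_const:
  assumes M: "pointed_matroid M" and N: "pointed_matroid N"
  shows "(\<lambda>x \<in> ground M. pt N) \<in> strong_maps M N"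
proof -
  have "(\<lambda>x \<in> ground M. pt N) -` A \<inter> ground M = ground M" if "A \<in> flats N" for A
    using pt_in_flat[OF N that] by auto
  then show ?thesis
    using ground_in_flats[OF M] M N by (simp add: strong_maps_def pointed_matroid_def)
qed

lemma zero_object_Mat:
  "zero_object Mat (M :: 'a pmatroid) \<longleftrightarrow> pointed_matroid M \<and> ground M = {pt M}"
proof
  assume z: "zero_object Mat M"
  then have M: "pointed_matroid M" by (simp add: zero_object_def)
  then have pM: "pt M \<in> ground M" by (simp add: pointed_matroid_def)
  have "\<exists>!f. f \<in> strong_maps M M" using z by (simp add: zero_object_def)
  then have eq: "(\<lambda>x \<in> ground M. pt M) = (\<lambda>x \<in> ground M. x)"
    using strong_maps_id[OF M] strong_maps_const[OF M M] by blast
  have "x = pt M" if "x \<in> ground M" for x using that fun_cong[OF eq, of x] by simp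
  then show "pointed_matroid M \<and> ground M = {pt M}" using M pM by blast
next
  assume *: "pointed_matroid M \<and> ground M = {pt M}"
  then have M: "pointed_matroid M" and g: "ground M = {pt M}" by auto
  show "zero_object Mat M"
    unfolding zero_object_def
  proof (intro conjI ballI)
    show "M \<in> Obj Mat" using M by simp
    fix X :: "'a pmatroid" assume "X \<in> Obj Mat"
    then have X: "pointed_matroid X" by simp
    have "f = (\<lambda>x \<in> ground M. pt X)" if "f \<in> strong_maps M X" for f
      using that g by (intro strong_maps_eqI[OF that strong_maps_const[OF M X]])
        (simp add: strong_maps_def)
    then show "\<exists>!f. f \<in> Hom Mat M X" using strong_maps_const[OF M X] by auto
    have "f = (\<lambda>x \<in> ground X. pt M)" if f: "f \<in> strong_maps X M" for f
    proof (rule strong_maps_eqI[OF f strong_maps_const[OF X M]])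
      fix x assume "x \<in> ground X"
      then have "f x \<in> {pt M}" using f g by (metis (no_types, lifting) PiE_mem mem_Collect_eq strong_maps_def)
      then show "f x = (\<lambda>x \<in> ground X. pt M) x" using \<open>x \<in> ground X\<close> by simp
    qed
    then show "\<exists>!f. f \<in> Hom Mat X M" using strong_maps_const[OF X M] by auto
  qed
qed

lemma restriction_incl_strong:
  assumes M: "pointed_matroid M" and S: "S \<subseteq> ground M" "pt M \<in> S"
  shows "restriction_incl S \<in> strong_maps (restriction M S) M"
proof -
  have "restriction_incl S -` A \<inter> S = A \<inter> S" for A by (auto simp: restriction_incl_def)
  then show ?thesis using S flats_restriction[OF M S(1)]
    by (auto simp: strong_maps_def restriction_incl_def)
qed

lemma contraction_proj_strong:
  assumes M: "pointed_matroid M" and S: "S \<subseteq> ground M" "pt M \<notin> S"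
  shows "contraction_proj M S \<in> strong_maps M (contraction M S)"
proof -
  have "contraction_proj M S -` (A - S) \<inter> ground M = A" if "A \<in> flats M" "S \<subseteq> A" for A
  proof -
    have "pt M \<in> A" "A \<subseteq> ground M" using that(1) pt_in_flat[OF M] flats_iff[OF M] by auto
    then show ?thesis using that(2) S by (auto simp: contraction_proj_def split: if_splits)
  qed
  then show ?thesis using M S flats_contraction[OF M S(1)]
    by (auto simp: strong_maps_def contraction_proj_def pointed_matroid_def)
qed

lemma is_isomorphism_Id_Mat:
  "pointed_matroid M \<Longrightarrow> is_isomorphism Mat_category M M (\<lambda>x \<in> ground M. x)"
  using strong_maps_id[of M]
  unfolding is_isomorphism_def
  by (intro conjI bexI[of _ "\<lambda>x \<in> ground M. x"])
    (auto simp: Mat_category_def compose_def intro!: restrict_ext)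

lemma restriction_incl_Mat_mono:
  assumes M: "pointed_matroid M" and S: "S \<subseteq> ground M" "pt M \<in> S"
  shows "restriction_incl S \<in> Mat_monos (restriction M S) M"
  unfolding Mat_monos_def mem_Collect_eq
  using S restriction_incl_strong[OF M S] is_isomorphism_Id_Mat[OF pointed_matroid_restriction[OF M S]]
  by (intro conjI exI[of _ S] exI[of _ "\<lambda>x\<in>S. x"])
    (auto simp: Mat_category_def compose_def restriction_incl_def fun_eq_iff)

lemma contraction_proj_Mat_epi:
  assumes M: "pointed_matroid M" and S: "S \<subseteq> ground M" "pt M \<notin> S"
  shows "contraction_proj M S \<in> Mat_epis M (contraction M S)"
proof -
  have "contraction_proj M S = compose (ground M) (\<lambda>x \<in> ground M - S. x) (contraction_proj M S)"
    using S M by (auto simp: contraction_proj_def compose_def fun_eq_iff pointed_matroid_def)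
  then show ?thesis
    unfolding Mat_epis_def mem_Collect_eq
    using S contraction_proj_strong[OF M S] is_isomorphism_Id_Mat[OF pointed_matroid_contraction[OF M S]]
    by (intro conjI exI[of _ S] exI[of _ "\<lambda>x\<in>ground M - S. x"]) (auto simp: Mat_category_def)
qed

text \<open>
  Every set \<open>S\<close> of non-distinguished elements of \<open>M\<close> gives an admissible short exact sequence
  \<open>M|(S \<union> {*}) \<rightarrow> M \<rightarrow> M/S\<close>.
\<close>

lemma admissible_ses_restriction_contraction:
  fixes M :: "'a pmatroid"
  assumes M: "pointed_matroid M" and S: "S \<subseteq> ground M" "pt M \<notin> S"
  defines "R \<equiv> insert (pt M) S"
  shows "admissible_ses Mat (restriction M R) M (contraction M S)
    (restriction_incl R) (contraction_proj M S)"
proof -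
  have R: "R \<subseteq> ground M" "pt M \<in> R" using M S by (auto simp: R_def pointed_matroid_def)
  let ?A = "restriction M R" and ?D = "contraction M S"
  have A: "pointed_matroid ?A" and D: "pointed_matroid ?D"
    using pointed_matroid_restriction[OF M R] pointed_matroid_contraction[OF M S] by auto
  let ?p = "contraction_proj ?A S" and ?N = "contraction ?A S"
  have S': "S \<subseteq> ground ?A" "pt ?A \<notin> S" using S by (auto simp: R_def)
  have N: "pointed_matroid ?N" "ground ?N = {pt M}"
    using pointed_matroid_contraction[OF A S'] S by (auto simp: R_def)
  have zN: "zero_object Mat ?N" using N by (simp add: zero_object_Mat)
  have p: "?p \<in> Mat_epis ?A ?N" by (rule contraction_proj_Mat_epi[OF A S'])
  have P: "{pt M} \<subseteq> ground ?D" "pt ?D \<in> {pt M}" using R S by auto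
  have "restriction ?D {pt M} = ?N"
  proof (rule pmatroid_eqI)
    show r: "pointed_matroid (restriction ?D {pt M})"
      by (rule pointed_matroid_restriction[OF D P])
    show "flats (restriction ?D {pt M}) = flats ?N"
      using singleton_pmatroid[OF r] singleton_pmatroid[OF N(1)] N(2) by simp
  qed (use N in auto)
  then have j: "restriction_incl {pt M} \<in> Mat_monos ?N ?D"
    using restriction_incl_Mat_mono[OF D P] by simp
  let ?i = "restriction_incl R" and ?q = "contraction_proj M S" and ?j = "restriction_incl {pt M}"
  note strong = restriction_incl_strong[OF M R] contraction_proj_strong[OF M S]
    contraction_proj_strong[OF A S']
  have comm: "commutative_square Mat ?A M ?N ?D ?i ?p ?q ?j"
    unfolding commutative_square_def
    using M A N D strong j
    by (auto simp: compose_def Mat_monos_def restriction_incl_def contraction_proj_def R_def S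
        R[unfolded R_def] fun_eq_iff intro!: restrict_ext dest: subsetD[OF S(1)])
  have "cartesian_square Mat ?A M ?N ?D ?i ?p ?q ?j"
    unfolding cartesian_square_def
  proof (intro conjI comm ballI impI)
    fix T :: "'a pmatroid" and u v
    assume T: "T \<in> Obj Mat" and u: "u \<in> Hom Mat T M" and v: "v \<in> Hom Mat T ?N"
      and eq: "Comp Mat T M ?D ?q u = Comp Mat T ?N ?D ?j v"
    have v1: "v x = pt M" if "x \<in> ground T" for x
      using v that N(2) by (auto simp: strong_maps_def)
    have u1: "u x \<in> R" if "x \<in> ground T" for x
      using fun_cong[OF eq, of x] that v1[OF that] u
      by (auto simp: compose_def restriction_incl_def contraction_proj_def R_def strong_maps_def
          split: if_splits)
    have "u -` (A \<inter> R) \<inter> ground T = u -` A \<inter> ground T" for A using u1 by auto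
    then have us: "u \<in> strong_maps T ?A"
      using u u1 flats_restriction[OF M R(1)] by (auto simp: strong_maps_def PiE_def)
    show "\<exists>!w. w \<in> Hom Mat T ?A \<and> Comp Mat T ?A M ?i w = u \<and> Comp Mat T ?A ?N ?p w = v"
    proof (rule ex1I)
      have "compose (ground T) ?i u = u"
        using u u1 by (auto simp: compose_def restriction_incl_def fun_eq_iff strong_maps_def PiE_def
            extensional_def)
      moreover have "compose (ground T) ?p u = v"
        using v u1 v1 S by (auto simp: compose_def contraction_proj_def fun_eq_iff strong_maps_def
            PiE_def extensional_def R_def)
      ultimately show "u \<in> Hom Mat T ?A \<and> Comp Mat T ?A M ?i u = u \<and> Comp Mat T ?A ?N ?p u = v"
        using us by simp
    next
      fix w assume w: "w \<in> Hom Mat T ?A \<and> Comp Mat T ?A M ?i w = u \<and> Comp Mat T ?A ?N ?p w = v"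
      then have ws: "w \<in> ground T \<rightarrow>\<^sub>E R" by (simp add: strong_maps_def)
      have "w x = u x" if "x \<in> ground T" for x
        using w ws that by (auto simp: compose_def restriction_incl_def)
      then show "w = u" using ws u
        by (auto simp: strong_maps_def PiE_def intro: extensionalityI)
    qed
  qed
  moreover have "cocartesian_square Mat ?A M ?N ?D ?i ?p ?q ?j"
    unfolding cocartesian_square_def
  proof (intro conjI comm ballI impI)
    fix T :: "'a pmatroid" and u v
    assume T: "T \<in> Obj Mat" and u: "u \<in> Hom Mat M T" and v: "v \<in> Hom Mat ?N T"
      and eq: "Comp Mat ?A M T u ?i = Comp Mat ?A ?N T v ?p"
    have uh: "u \<in> ground M \<rightarrow>\<^sub>E ground T" "u (pt M) = pt T" using u by (auto simp: strong_maps_def)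
    have vh: "v \<in> {pt M} \<rightarrow>\<^sub>E ground T" "v (pt M) = pt T"
      using v N(2) by (auto simp: strong_maps_def)
    have u1: "u x = pt T" if "x \<in> S" for x
      using fun_cong[OF eq, of x] that vh S
      by (auto simp: compose_def restriction_incl_def contraction_proj_def R_def)
    let ?w = "restrict u (ground M - S)"
    have "?w \<in> strong_maps ?D T"
    proof -
      have "?w -` B \<inter> (ground M - S) \<in> flats ?D" if B: "B \<in> flats T" for B
      proof -
        have "pt T \<in> B" using pt_in_flat T B by auto
        then have "S \<subseteq> u -` B \<inter> ground M" using u1 S by auto
        moreover have "u -` B \<inter> ground M \<in> flats M" using u B by (auto simp: strong_maps_def)
        moreover have "?w -` B \<inter> (ground M - S) = (u -` B \<inter> ground M) - S" by auto
        ultimately show ?thesis using flats_contraction[OF M S(1)] by blast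
      qed
      then show ?thesis using uh P by (auto simp: strong_maps_def)
    qed
    moreover have "compose (ground M) ?w ?q = u"
    proof
      fix x show "compose (ground M) ?w ?q x = u x"
        using uh u1 S P by (auto simp: compose_def contraction_proj_def PiE_def extensional_def)
    qed
    moreover have "compose {pt M} ?w ?j = v"
    proof
      fix x show "compose {pt M} ?w ?j x = v x"
        using uh vh S P by (auto simp: compose_def restriction_incl_def PiE_def extensional_def)
    qed
    ultimately have ex: "?w \<in> Hom Mat ?D T \<and> Comp Mat M ?D T ?w ?q = u \<and> Comp Mat ?N ?D T ?w ?j = v"
      using N(2) by simp
    show "\<exists>!w. w \<in> Hom Mat ?D T \<and> Comp Mat M ?D T w ?q = u \<and> Comp Mat ?N ?D T w ?j = v"
    proof (rule ex1I)
      show "?w \<in> Hom Mat ?D T \<and> Comp Mat M ?D T ?w ?q = u \<and> Comp Mat ?N ?D T ?w ?j = v"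
        by (fact ex)
      fix w assume w: "w \<in> Hom Mat ?D T \<and> Comp Mat M ?D T w ?q = u \<and> Comp Mat ?N ?D T w ?j = v"
      then have ws: "w \<in> ground M - S \<rightarrow>\<^sub>E ground T" and e: "compose (ground M) w ?q = u"
        by (auto simp: strong_maps_def)
      show "w = ?w"
      proof (rule extensionalityI[where A = "ground M - S"])
        fix x assume "x \<in> ground M - S"
        then show "w x = ?w x" using fun_cong[OF e, of x]
          by (auto simp: compose_def contraction_proj_def)
      qed (use ws in \<open>auto simp: PiE_def\<close>)
    qed
  qed
  ultimately show ?thesis
    unfolding admissible_ses_def
    using restriction_incl_Mat_mono[OF M R] contraction_proj_Mat_epi[OF M S] zN p j by auto
qed

end

theory Submission
  imports Defs
begin

text \<open>
  Rank and nullity are additive along admissible short exact sequences, hence define a homomorphism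
  from the Grothendieck group to \<open>\<int> \<oplus> \<int>\<close>. Conversely, contracting one element at a time
  expresses the class of every matroid by the classes \<open>l\<close> of a loop and \<open>c\<close> of a coloop. These
  commute, since \<open>l c\<close> and \<open>c l\<close> are both the class of the direct sum of a loop and a coloop. So
  the class of \<open>M\<close> is \<open>l\<close> to the nullity times \<open>c\<close> to the rank, which makes the homomorphism
  injective; \<open>l\<close> and \<open>c\<close> are mapped to the standard basis.
\<close>

section \<open>Isomorphism classes\<close>

context category
begin

lemma is_isomorphism_Id: "X \<in> Obj C \<Longrightarrow> is_isomorphism C X X (Id C X)"
  unfolding is_isomorphism_def using Id_in_Hom Comp_Id_left by blast

lemma is_isomorphism_Comp:
  assumes "X \<in> Obj C" "Y \<in> Obj C" "Z \<in> Obj C"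
    and f: "is_isomorphism C X Y f" and g: "is_isomorphism C Y Z g"
  shows "is_isomorphism C X Z (Comp C X Y Z g f)"
proof -
  obtain f' where f': "f \<in> Hom C X Y" "f' \<in> Hom C Y X"
      "Comp C X Y X f' f = Id C X" "Comp C Y X Y f f' = Id C Y"
    using f by (auto simp: is_isomorphism_def)
  obtain g' where g': "g \<in> Hom C Y Z" "g' \<in> Hom C Z Y"
      "Comp C Y Z Y g' g = Id C Y" "Comp C Z Y Z g g' = Id C Z"
    using g by (auto simp: is_isomorphism_def)
  let ?h = "Comp C X Y Z g f" and ?h' = "Comp C Z Y X f' g'"
  have h: "?h \<in> Hom C X Z" "?h' \<in> Hom C Z X"
    using assms(1-3) f' g' by (auto intro: Comp_in_Hom)
  have "Comp C X Z X ?h' ?h = Comp C X Y X f' (Comp C X Z Y g' ?h)"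
    using Comp_assoc[of X Z Y X ?h g' f'] assms(1-3) f' g' h by simp
  also have "Comp C X Z Y g' ?h = f"
    using Comp_assoc[of X Y Z Y f g g'] assms(1-3) f' g' by (simp add: Comp_Id_left)
  finally have 1: "Comp C X Z X ?h' ?h = Id C X" using f' by simp
  have "Comp C Z X Z ?h ?h' = Comp C Z Y Z g (Comp C Z X Y f ?h')"
    using Comp_assoc[of Z X Y Z ?h' f g] assms(1-3) f' g' h by simp
  also have "Comp C Z X Y f ?h' = g'"
    using Comp_assoc[of Z Y X Y g' f' f] assms(1-3) f' g' by (simp add: Comp_Id_left)
  finally have "Comp C Z X Z ?h ?h' = Id C Z" using g' by simp
  with 1 h show ?thesis by (auto simp: is_isomorphism_def)
qed

lemma equiv_iso_rel: "equiv (Obj C) (iso_rel C)"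
proof (rule equivI)
  show "iso_rel C \<subseteq> Obj C \<times> Obj C" by (auto simp: iso_rel_def)
  show "refl_on (Obj C) (iso_rel C)"
    using is_isomorphism_Id by (auto simp: refl_on_def iso_rel_def)
  show "sym (iso_rel C)"
    by (auto simp: sym_def iso_rel_def is_isomorphism_def)
  show "trans (iso_rel C)"
    unfolding trans_def iso_rel_def using is_isomorphism_Comp by blast
qed

lemma iso_class_eq: "\<lbrakk>X \<in> Obj C; Y \<in> Obj C; is_isomorphism C X Y f\<rbrakk> \<Longrightarrow> iso_class C X = iso_class C Y"
  unfolding iso_class_def
  by (rule equiv_class_eq[OF equiv_iso_rel]) (auto simp: iso_rel_def)

lemma iso_class_self: "X \<in> Obj C \<Longrightarrow> X \<in> iso_class C X"
  unfolding iso_class_def by (rule equiv_class_self[OF equiv_iso_rel])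

end


section \<open>The rank function of a matroid\<close>

text \<open>The usual matroid rank, taken as the least size of a subset of \<open>X\<close> that
  spans \<open>X\<close>, so that bases and independent sets are not introduced. For
  \<open>X\<close> in the ground set, \<open>Min\<close> ranges over a nonempty set, since
  \<open>X\<close> spans itself.\<close>

definition rank_of :: "'a pmatroid \<Rightarrow> 'a set \<Rightarrow> nat" where
  "rank_of M X = Min (card ` {I. I \<subseteq> X \<and> X \<subseteq> cl M I})"

locale pointed =
  fixes M :: "'a pmatroid"
  assumes pm: "pointed_matroid M"
begin

lemma mat: "matroid (ground M) (cl M)"
  using pm by (simp add: pointed_matroid_def)

lemmas fin = matroid_finite[OF mat]
lemmas cl_closed = matroid_closed[OF mat]
lemmas cl_ext = matroid_extensive[OF mat]
lemmas cl_mono = matroid_mono[OF mat]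
lemmas cl_idem = matroid_idem[OF mat]
lemmas cl_exchange = matroid_exchange[OF mat]

lemma pt_ground: "pt M \<in> ground M" and pt_loop: "pt M \<in> cl M {}"
  using pm by (auto simp: pointed_matroid_def)

lemma pt_cl: "X \<subseteq> ground M \<Longrightarrow> pt M \<in> cl M X"
  using cl_mono[of "{}" X] pt_loop by auto

lemma cl_subset_cl: "\<lbrakk>X \<subseteq> cl M Y; Y \<subseteq> ground M\<rbrakk> \<Longrightarrow> cl M X \<subseteq> cl M Y"
  using cl_mono[of X "cl M Y"] cl_idem[of Y] cl_closed[of Y] by simp

lemma finite_spanning: "X \<subseteq> ground M \<Longrightarrow> finite {I. I \<subseteq> X \<and> X \<subseteq> cl M I}"
  using finite_subset[OF _ fin] by (auto intro!: finite_subset[of _ "Pow X"])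

lemma rank_of_le: "\<lbrakk>X \<subseteq> ground M; I \<subseteq> X; X \<subseteq> cl M I\<rbrakk> \<Longrightarrow> rank_of M X \<le> card I"
  unfolding rank_of_def by (intro Min_le finite_imageI finite_spanning imageI) auto

lemma rank_of_witness:
  assumes "X \<subseteq> ground M"
  obtains I where "I \<subseteq> X" "X \<subseteq> cl M I" "card I = rank_of M X"
proof -
  have "X \<in> {I. I \<subseteq> X \<and> X \<subseteq> cl M I}" using cl_ext[OF assms] by simp
  then have "rank_of M X \<in> card ` {I. I \<subseteq> X \<and> X \<subseteq> cl M I}"
    unfolding rank_of_def using finite_spanning[OF assms] by (intro Min_in finite_imageI) blast+
  then show ?thesis using that by auto
qed

lemma rank_of_empty [simp]: "rank_of M {} = 0"
  using rank_of_le[of "{}" "{}"] by simp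

text \<open>Deleting \<open>x\<close> from a minimum spanning set of \<open>insert x X\<close>, or
  exchanging it for an element of \<open>X\<close>, gives a spanning set of \<open>X\<close>. This
  is where the exchange axiom enters.\<close>

lemma rank_of_insert:
  assumes X: "X \<subseteq> ground M" and x: "x \<in> ground M"
  shows "rank_of M (insert x X) = rank_of M X + (if x \<in> cl M X then 0 else 1)"
proof -
  obtain I where I: "I \<subseteq> X" "X \<subseteq> cl M I" "card I = rank_of M X"
    using rank_of_witness[OF X] .
  have Xx: "insert x X \<subseteq> ground M" using X x by simp
  obtain K where K: "K \<subseteq> insert x X" "insert x X \<subseteq> cl M K" "card K = rank_of M (insert x X)"
    using rank_of_witness[OF Xx] .
  define J where "J = K - {x}"
  have J: "J \<subseteq> X" "J \<subseteq> ground M" "K \<subseteq> insert x J" using K X by (auto simp: J_def)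
  have finI: "finite I" "finite J" "finite K"
    using I J K X Xx fin by (meson finite_subset)+
  have Kx: "K = insert x J" if "\<not> X \<subseteq> cl M J"
    using that K by (cases "x \<in> K") (auto simp: J_def)
  \<comment> \<open>As \<open>K\<close> spans \<open>y\<close> and \<open>J\<close> does not, the
    exchange axiom trades \<open>x\<close> for \<open>y\<close>, so \<open>insert y J\<close> can
    replace \<open>K\<close>.\<close>
  have exch: "x \<in> cl M (insert y J)" if "y \<in> X" "y \<notin> cl M J" for y
  proof -
    have "K = insert x J" using that Kx by auto
    then have "y \<in> cl M (insert x J)" using that K by auto
    then show ?thesis using that cl_exchange[of J x y] J X x by auto
  qed
  show ?thesis
  proof (cases "x \<in> cl M X")
    case True
    have "cl M X \<subseteq> cl M I" using cl_subset_cl I X by auto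
    then have "rank_of M (insert x X) \<le> card I" using True I by (intro rank_of_le[OF Xx]) auto
    moreover have "rank_of M X \<le> card K"
    proof (cases "X \<subseteq> cl M J")
      case True
      have "card J \<le> card K" using finI by (auto simp: J_def intro: card_mono)
      then show ?thesis using rank_of_le[OF X J(1) True] by simp
    next
      case False
      then obtain y where y: "y \<in> X" "y \<notin> cl M J" by auto
      have yJ: "insert y J \<subseteq> ground M" using y J X by auto
      have "K \<subseteq> cl M (insert y J)" using exch[OF y] cl_ext[OF yJ] J by auto
      then have "X \<subseteq> cl M (insert y J)" using cl_subset_cl[OF _ yJ, of K] K by blast
      then have "rank_of M X \<le> card (insert y J)" using y J by (intro rank_of_le[OF X]) auto
      also have "\<dots> \<le> card K" using Kx[OF False] y J finI card_insert_disjoint[of J x] card_insert_if[of J y]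
        by (auto simp: J_def)
      finally show ?thesis .
    qed
    ultimately show ?thesis using True I K by simp
  next
    case False
    have xI: "insert x I \<subseteq> ground M" using I X x by auto
    have "insert x X \<subseteq> cl M (insert x I)"
      using cl_ext[OF xI] cl_mono[OF _ xI, of I] I by auto
    then have "rank_of M (insert x X) \<le> card (insert x I)"
      using I by (intro rank_of_le[OF Xx]) auto
    then have 1: "rank_of M (insert x X) \<le> rank_of M X + 1"
      using I finI by (simp add: card_insert_if split: if_splits)
    \<comment> \<open>A spanning set inside \<open>X\<close> would put \<open>x\<close> into the
      closure of \<open>X\<close>.\<close>
    have "x \<in> K"
    proof (rule ccontr)
      assume "x \<notin> K"
      then have "cl M K \<subseteq> cl M X" using K cl_mono[OF _ X] by auto
      then show False using False K by auto
    qed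
    then have cK: "card K = Suc (card J)" using finI by (metis J_def card_Suc_Diff1)
    \<comment> \<open>An element of \<open>X\<close> outside the closure of \<open>J\<close> would,
      by exchange, put \<open>x\<close> into the closure of \<open>X\<close>. So \<open>J\<close>,
      one element smaller than \<open>K\<close>, spans \<open>X\<close>.\<close>
    have "X \<subseteq> cl M J"
    proof
      fix y assume y: "y \<in> X"
      show "y \<in> cl M J"
      proof (rule ccontr)
        assume "y \<notin> cl M J"
        then have "x \<in> cl M (insert y J)" using exch y by simp
        then show False using False cl_mono[OF _ X, of "insert y J"] y J by auto
      qed
    qed
    then have "rank_of M X \<le> card J" using rank_of_le[OF X J(1)] by simp
    then show ?thesis using 1 False cK K by simp
  qed
qed

text \<open>Strong maps are defined through flats, rank through closure; this links the two.\<close>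

lemma mem_cl_iff:
  assumes "X \<subseteq> ground M"
  shows "x \<in> cl M X \<longleftrightarrow> (\<forall>A \<in> flats M. X \<subseteq> A \<longrightarrow> x \<in> A)"
proof -
  have "cl M X \<in> flats M" using assms by (auto simp: flats_def)
  moreover have "cl M X \<subseteq> A" if "A \<in> flats M" "X \<subseteq> A" for A
    using that flats_iff[OF pm] cl_mono[of X A] by auto
  ultimately show ?thesis using cl_ext[OF assms] by blast
qed

end

section \<open>Rank under restriction and contraction\<close>

text \<open>By \<open>rank_of_insert\<close> the growth of the rank depends only on closure
  membership, which \<open>g\<close> matches. The base sets \<open>K\<close> and \<open>K'\<close>
  let one induction serve restriction, contraction and isomorphism.\<close>

lemma rank_of_transfer:
  assumes "pointed_matroid M" "pointed_matroid N" and X: "X \<subseteq> ground M" "g ` X \<subseteq> ground N"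
    and K: "K \<subseteq> ground M" "K' \<subseteq> ground N"
    and cl: "\<And>x Y. \<lbrakk>Y \<subseteq> X; x \<in> X\<rbrakk> \<Longrightarrow> x \<in> cl M (K \<union> Y) \<longleftrightarrow> g x \<in> cl N (K' \<union> g ` Y)"
  shows "rank_of M (K \<union> X) + rank_of N K' = rank_of M K + rank_of N (K' \<union> g ` X)"
proof -
  interpret M: pointed M by standard fact
  interpret N: pointed N by standard fact
  have "finite X" using X M.fin finite_subset by blast
  moreover have "rank_of M (K \<union> Y) + rank_of N K' = rank_of M K + rank_of N (K' \<union> g ` Y)"
    if "finite Y" "Y \<subseteq> X" for Y
    using that
  proof (induction Y)
    case (insert x Y)
    have "K \<union> Y \<subseteq> ground M" "K' \<union> g ` Y \<subseteq> ground N" "x \<in> ground M" "g x \<in> ground N"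
      using insert.prems X K by blast+
    then show ?case
      using insert M.rank_of_insert[of "K \<union> Y" x] N.rank_of_insert[of "K' \<union> g ` Y" "g x"] cl[of Y x]
      by simp
  qed simp
  ultimately show ?thesis by blast
qed

lemma rank_of_restriction:
  assumes M: "pointed_matroid M" and S: "S \<subseteq> ground M" "pt M \<in> S"
  shows "rank_of (restriction M S) S = rank_of M S"
proof -
  have *: "pointed_matroid (restriction M S)" by (rule pointed_matroid_restriction[OF M S])
  have "rank_of M ({} \<union> S) + rank_of (restriction M S) {} =
      rank_of M {} + rank_of (restriction M S) ({} \<union> (\<lambda>x. x) ` S)"
    by (rule rank_of_transfer[OF M *]) (use S cl_restriction[OF M S(1)] in auto)
  then show ?thesis using pointed.rank_of_empty[of M] pointed.rank_of_empty[of "restriction M S"] M *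
    by (simp add: pointed_def)
qed

text \<open>Transfer with base \<open>S\<close> in \<open>M\<close> and the empty base in the
  contraction, whose closure is that of \<open>M\<close> after adding \<open>S\<close>.\<close>

lemma rank_of_contraction:
  assumes M: "pointed_matroid M" and S: "S \<subseteq> ground M" "pt M \<notin> S"
  shows "rank_of M (ground M) = rank_of M S + rank_of (contraction M S) (ground M - S)"
proof -
  have *: "pointed_matroid (contraction M S)" by (rule pointed_matroid_contraction[OF M S])
  have "rank_of M (S \<union> (ground M - S)) + rank_of (contraction M S) {} =
      rank_of M S + rank_of (contraction M S) ({} \<union> (\<lambda>x. x) ` (ground M - S))"
    by (rule rank_of_transfer[OF M *])
      (use S cl_contraction[OF M S(1)] in \<open>auto simp: Un_commute\<close>)
  moreover have "S \<union> (ground M - S) = ground M" using S by auto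
  ultimately show ?thesis using pointed.rank_of_empty[of "contraction M S"] * by (simp add: pointed_def)
qed

text \<open>The point is a loop. This reconciles the restriction, whose ground set contains the
  point, with the contracted set, which does not.\<close>

lemma rank_of_insert_pt:
  assumes M: "pointed_matroid M" and S: "S \<subseteq> ground M"
  shows "rank_of M (insert (pt M) S) = rank_of M S"
proof -
  interpret pointed M by standard fact
  show ?thesis using rank_of_insert[OF S pt_ground] pt_cl[OF S] by simp
qed

section \<open>Rank and nullity as additive invariants\<close>

definition rank :: "'a pmatroid \<Rightarrow> int" where
  "rank M = int (rank_of M (ground M))"

text \<open>The distinguished loop is not counted by the nullity.\<close>

definition nullity :: "'a pmatroid \<Rightarrow> int" where
  "nullity M = int (card (ground M)) - 1 - rank M"

text \<open>The rank part is \<open>rank_of_contraction\<close>. For the nullity, the point lies in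
  both the restriction and the contraction, and the \<open>- 1\<close> in \<open>nullity\<close>
  compensates for this double count.\<close>

lemma rank_nullity_additive:
  assumes M: "pointed_matroid M" and S: "S \<subseteq> ground M" "pt M \<notin> S"
  shows "rank M = rank (restriction M (insert (pt M) S)) + rank (contraction M S)"
    and "nullity M = nullity (restriction M (insert (pt M) S)) + nullity (contraction M S)"
proof -
  interpret pointed M by standard fact
  have S': "insert (pt M) S \<subseteq> ground M" "pt M \<in> insert (pt M) S" using S pt_ground by auto
  show 1: "rank M = rank (restriction M (insert (pt M) S)) + rank (contraction M S)"
    using rank_of_contraction[OF M S] rank_of_restriction[OF M S'] rank_of_insert_pt[OF M S(1)]
    by (simp add: rank_def)
  have "finite S" using S fin finite_subset by blast
  moreover have "card (ground M - S) = card (ground M) - card S" "card S \<le> card (ground M)"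
    using S fin by (auto simp: card_Diff_subset card_mono \<open>finite S\<close>)
  ultimately show "nullity M = nullity (restriction M (insert (pt M) S)) + nullity (contraction M S)"
    using 1 S by (simp add: nullity_def of_nat_diff)
qed


section \<open>Isomorphisms and exact sequences of pointed matroids\<close>

interpretation Mat: category Mat
  by (rule category_Mat)

lemma Comp_Mat_category: "Comp Mat_category M N P g f = compose (ground M) g f"
  by (simp add: Mat_category_def)

text \<open>The admissible maps are formulated over \<open>Mat_category\<close>, the exact sequences
  over \<open>Mat\<close>; this passes between them.\<close>

lemma is_isomorphism_Mat: "is_isomorphism Mat_category = is_isomorphism Mat"
  by (simp add: fun_eq_iff is_isomorphism_def Mat_category_def)

text \<open>The preimage of a flat containing the image of \<open>X\<close> is a flat containing
  \<open>X\<close>, hence contains \<open>x\<close>.\<close>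

lemma strong_map_cl:
  assumes M: "pointed_matroid M" and N: "pointed_matroid N"
    and f: "f \<in> strong_maps M N" and X: "X \<subseteq> ground M" and x: "x \<in> cl M X"
  shows "f x \<in> cl N (f ` X)"
proof -
  interpret M: pointed M by standard fact
  interpret N: pointed N by standard fact
  have fX: "f ` X \<subseteq> ground N" using f X by (auto simp: strong_maps_def)
  have "f x \<in> A" if "A \<in> flats N" "f ` X \<subseteq> A" for A
  proof -
    have "f -` A \<inter> ground M \<in> flats M" using f that by (auto simp: strong_maps_def)
    moreover have "X \<subseteq> f -` A \<inter> ground M" using that X by auto
    ultimately show ?thesis using x M.mem_cl_iff[OF X] by blast
  qed
  then show ?thesis using N.mem_cl_iff[OF fX] by blast
qed

lemma is_isomorphism_MatE:
  assumes f: "is_isomorphism Mat M N f"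
  obtains g where "f \<in> strong_maps M N" "g \<in> strong_maps N M"
    "\<And>x. x \<in> ground M \<Longrightarrow> g (f x) = x" "\<And>y. y \<in> ground N \<Longrightarrow> f (g y) = y"
    "bij_betw f (ground M) (ground N)"
proof -
  obtain g where g: "f \<in> strong_maps M N" "g \<in> strong_maps N M"
    "compose (ground M) g f = (\<lambda>x \<in> ground M. x)" "compose (ground N) f g = (\<lambda>x \<in> ground N. x)"
    using f by (auto simp: is_isomorphism_def)
  have 1: "g (f x) = x" if "x \<in> ground M" for x
    using fun_cong[OF g(3), of x] that by (simp add: compose_def)
  have 2: "f (g x) = x" if "x \<in> ground N" for x
    using fun_cong[OF g(4), of x] that by (simp add: compose_def)
  have "bij_betw f (ground M) (ground N)"
    by (rule bij_betw_byWitness[of _ g]) (use g 1 2 in \<open>auto simp: strong_maps_def\<close>)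
  then show ?thesis using that g 1 2 by blast
qed

text \<open>An isomorphism and its inverse both preserve closures, so closure membership corresponds
  exactly and \<open>rank_of_transfer\<close> applies with empty bases.\<close>

lemma rank_nullity_isomorphic:
  assumes M: "pointed_matroid M" and N: "pointed_matroid N" and f: "is_isomorphism Mat M N f"
  shows "rank M = rank N" "nullity M = nullity N"
proof -
  obtain g where g: "f \<in> strong_maps M N" "g \<in> strong_maps N M"
    "\<And>x. x \<in> ground M \<Longrightarrow> g (f x) = x" "\<And>y. y \<in> ground N \<Longrightarrow> f (g y) = y"
    and b: "bij_betw f (ground M) (ground N)"
    using is_isomorphism_MatE[OF f] by blast
  have im: "f ` ground M = ground N" using b by (simp add: bij_betw_def)
  have cl: "x \<in> cl M Y \<longleftrightarrow> f x \<in> cl N (f ` Y)" if Y: "Y \<subseteq> ground M" and x: "x \<in> ground M" for x Y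
  proof
    show "x \<in> cl M Y \<Longrightarrow> f x \<in> cl N (f ` Y)" using strong_map_cl[OF M N g(1) Y] .
    assume "f x \<in> cl N (f ` Y)"
    then have "g (f x) \<in> cl M (g ` f ` Y)"
      using strong_map_cl[OF N M g(2)] Y im by blast
    moreover have "g ` f ` Y = Y" using g(3) Y by (force simp: image_image subset_iff)
    ultimately show "x \<in> cl M Y" using g(3) x by simp
  qed
  have "rank_of M ({} \<union> ground M) + rank_of N {} = rank_of M {} + rank_of N ({} \<union> f ` ground M)"
    by (rule rank_of_transfer[OF M N]) (use im cl in auto)
  then show r: "rank M = rank N"
    using M N im pointed.rank_of_empty[of M] pointed.rank_of_empty[of N]
    by (simp add: rank_def pointed_def)
  show "nullity M = nullity N" using r bij_betw_same_card[OF b] by (simp add: nullity_def)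
qed

section \<open>The shape of admissible exact sequences\<close>

text \<open>Converse, up to isomorphism, of \<open>admissible_ses_restriction_contraction\<close>.
  If \<open>i\<close> comes from restricting to \<open>R\<close> and \<open>q\<close> from
  contracting \<open>S\<close>, then commutativity puts \<open>R\<close> inside
  \<open>insert (pt B) S\<close>, and the Cartesian property gives the other inclusion.\<close>

lemma admissible_ses_MatE:
  fixes A B D :: "'a pmatroid"
  assumes ses: "admissible_ses Mat A B D i q"
  obtains S g h where "S \<subseteq> ground B" "pt B \<notin> S"
    "is_isomorphism Mat A (restriction B (insert (pt B) S)) g"
    "is_isomorphism Mat (contraction B S) D h"
proof -
  obtain N p j where i: "i \<in> Mat_monos A B" and q: "q \<in> Mat_epis B D"
    and N: "zero_object Mat N" and p: "p \<in> Mat_epis A N" and j: "j \<in> Mat_monos N D"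
    and cart: "cartesian_square Mat A B N D i p q j"
    using ses by (auto simp: admissible_ses_def)
  have pm: "pointed_matroid A" "pointed_matroid B" "pointed_matroid D" "pointed_matroid N"
    and comm: "compose (ground A) q i = compose (ground A) j p"
    using cart by (auto simp: cartesian_square_def commutative_square_def)
  have gN: "ground N = {pt N}" using N by (simp add: zero_object_Mat)
  obtain R g where R: "pt B \<in> R" "R \<subseteq> ground B" "is_isomorphism Mat A (restriction B R) g"
    "i = compose (ground A) (restriction_incl R) g"
    using i by (auto simp: Mat_monos_def is_isomorphism_Mat Comp_Mat_category)
  obtain S h where S: "pt B \<notin> S" "S \<subseteq> ground B" "is_isomorphism Mat (contraction B S) D h"
    "q = compose (ground B) h (contraction_proj B S)"
    using q by (auto simp: Mat_epis_def is_isomorphism_Mat Comp_Mat_category)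
  have hs: "h \<in> strong_maps (contraction B S) D" "inj_on h (ground B - S)"
    using is_isomorphism_MatE[OF S(3)] by (auto simp: bij_betw_def)
  have gR: "g ` ground A = R"
    using is_isomorphism_MatE[OF R(3)] by (auto simp: bij_betw_def)
  have pB: "pt B \<in> ground B - S" "h (pt B) = pt D"
    using pm(2) S hs(1) by (auto simp: pointed_matroid_def strong_maps_def)
  \<comment> \<open>Injectivity of \<open>h\<close> is what keeps further elements from being sent
    to \<open>pt D\<close>.\<close>
  have qS: "q x = pt D \<longleftrightarrow> x \<in> insert (pt B) S" if "x \<in> ground B" for x
    using that pB S inj_onD[OF hs(2), of x "pt B"] by (auto simp: compose_def contraction_proj_def)
  have i_img: "i x \<in> R" if "x \<in> ground A" for x
    using that gR by (auto simp: R(4) compose_def restriction_incl_def)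
  \<comment> \<open>The composite of \<open>i\<close> and \<open>q\<close> passes through the zero
    object, so \<open>i\<close> lands where \<open>q\<close> is trivial.\<close>
  have R1: "R \<subseteq> insert (pt B) S"
  proof
    fix y assume y: "y \<in> R"
    then obtain x where x: "x \<in> ground A" "y = i x"
      using gR by (auto simp: R(4) compose_def restriction_incl_def)
    have "p x = pt N" "j (pt N) = pt D"
      using p j x gN by (auto simp: Mat_epis_def Mat_monos_def strong_maps_def)
    then have "q y = pt D" using fun_cong[OF comm, of x] x by (simp add: compose_def)
    then show "y \<in> insert (pt B) S" using qS y R by auto
  qed
  have S': "insert (pt B) S \<subseteq> ground B" "pt B \<in> insert (pt B) S" using S pB by auto
  let ?T = "restriction B (insert (pt B) S)"
  have T: "pointed_matroid ?T" by (rule pointed_matroid_restriction[OF pm(2) S'])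
  \<comment> \<open>The restriction to \<open>insert (pt B) S\<close> serves as test object for the
    pullback: its inclusion into \<open>B\<close> must factor through \<open>i\<close>.\<close>
  let ?u = "restriction_incl (insert (pt B) S)" and ?v = "\<lambda>x \<in> ground ?T. pt N"
  have u: "?u \<in> strong_maps ?T B" by (rule restriction_incl_strong[OF pm(2) S'])
  have v: "?v \<in> strong_maps ?T N" by (rule strong_maps_const[OF T pm(4)])
  have "j (pt N) = pt D" using j by (auto simp: Mat_monos_def strong_maps_def)
  then have "compose (ground ?T) q ?u = compose (ground ?T) j ?v"
    using qS S' by (auto simp: compose_def restriction_incl_def fun_eq_iff)
  then obtain w where w: "w \<in> strong_maps ?T A" "compose (ground ?T) i w = ?u"
    using cart T u v unfolding cartesian_square_def Mat_sel by blast
  have "insert (pt B) S \<subseteq> R"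
  proof
    fix x assume x: "x \<in> insert (pt B) S"
    then have "w x \<in> ground A" using w(1) by (auto simp: strong_maps_def)
    moreover have "i (w x) = x"
      using fun_cong[OF w(2), of x] x by (simp add: compose_def restriction_incl_def)
    ultimately show "x \<in> R" using i_img by force
  qed
  then have "R = insert (pt B) S" using R1 by auto
  then show ?thesis using that S R by blast
qed

lemma rank_nullity_ses:
  assumes ses: "admissible_ses Mat A B D i q"
  shows "rank B = rank A + rank D" "nullity B = nullity A + nullity D"
proof -
  have pm: "pointed_matroid A" "pointed_matroid B" "pointed_matroid D"
    using admissible_ses_Obj[OF ses] by auto
  obtain S g h where S: "S \<subseteq> ground B" "pt B \<notin> S"
    and g: "is_isomorphism Mat A (restriction B (insert (pt B) S)) g"
    and h: "is_isomorphism Mat (contraction B S) D h"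
    using admissible_ses_MatE[OF ses] .
  have "insert (pt B) S \<subseteq> ground B" using S pm by (simp add: pointed_matroid_def)
  then have R: "pointed_matroid (restriction B (insert (pt B) S))"
    using pointed_matroid_restriction[OF pm(2)] by simp
  show "rank B = rank A + rank D" "nullity B = nullity A + nullity D"
    using rank_nullity_additive[OF pm(2) S] rank_nullity_isomorphic[OF pm(1) R g]
      rank_nullity_isomorphic[OF pointed_matroid_contraction[OF pm(2) S] pm(3) h] by simp_all
qed

section \<open>Two-element pointed matroids: the loop and the coloop\<close>

text \<open>Every flat contains the point, so only two sets can be flats; the smaller one is a flat
  exactly when \<open>x\<close> is not a loop.\<close>

lemma flats_two_element:
  assumes M: "pointed_matroid M" and g: "ground M = {pt M, x}" "x \<noteq> pt M"
  shows "flats M = (if rank M = 0 then {ground M} else {{pt M}, ground M})"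
    and "rank M \<in> {0, 1}"
proof -
  interpret pointed M by standard fact
  have x: "x \<in> ground M" using g by simp
  have "rank_of M {pt M} = 0" using rank_of_insert_pt[OF M, of "{}"] by simp
  then have r: "rank M = (if x \<in> cl M {pt M} then 0 else 1)"
    using rank_of_insert[of "{pt M}" x] g by (simp add: rank_def insert_commute)
  have p: "pt M \<in> cl M {pt M}" using pt_cl[of "{pt M}"] g by simp
  have "cl M {pt M} \<subseteq> {pt M, x}" using cl_closed[of "{pt M}"] g by simp
  then have "{pt M} \<in> flats M \<longleftrightarrow> x \<notin> cl M {pt M}"
    using flats_iff[OF M, of "{pt M}"] g p by auto
  moreover have "A = {pt M} \<or> A = ground M" if "A \<in> flats M" for A
    using that pt_in_flat[OF M that] flats_iff[OF M] g by auto
  moreover have "ground M \<noteq> {pt M}" using g by auto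
  ultimately show "flats M = (if rank M = 0 then {ground M} else {{pt M}, ground M})"
    using r ground_in_flats[OF M] by auto
  show "rank M \<in> {0, 1}" using r by simp
qed

lemma two_element_strong_map:
  assumes M: "pointed_matroid M" and gM: "ground M = {pt M, x}" "x \<noteq> pt M"
    and N: "pointed_matroid N" and gN: "ground N = {pt N, y}" "y \<noteq> pt N"
    and r: "rank M = rank N"
  shows "(\<lambda>z \<in> ground M. if z = x then y else pt N) \<in> strong_maps M N" (is "?f \<in> _")
proof -
  have "?f -` {pt N} \<inter> ground M = {pt M}" "?f -` ground N \<inter> ground M = ground M"
    using gM gN by auto
  then have "?f -` A \<inter> ground M \<in> flats M" if "A \<in> flats N" for A
    using that flats_two_element[OF M gM] flats_two_element[OF N gN] r by (auto split: if_splits)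
  then show ?thesis using gM gN by (auto simp: strong_maps_def)
qed

text \<open>Equal ranks mean corresponding flats, so the pointed bijection and its inverse are both
  strong. Thus a single loop and a single coloop remain up to isomorphism.\<close>

lemma two_element_iso_class:
  assumes M: "pointed_matroid M" "card (ground M) = 2"
    and N: "pointed_matroid N" "card (ground N) = 2" and r: "rank M = rank N"
  shows "iso_class Mat M = iso_class Mat N"
proof -
  have *: "\<exists>x. ground L = {pt L, x} \<and> x \<noteq> pt L"
    if "pointed_matroid L" "card (ground L) = 2" for L :: "'a pmatroid"
  proof -
    have "pt L \<in> ground L" using that by (simp add: pointed_matroid_def)
    with that(2) show ?thesis by (auto simp: card_2_iff)
  qed
  obtain x where x: "ground M = {pt M, x}" "x \<noteq> pt M" using *[OF M] by auto
  obtain y where y: "ground N = {pt N, y}" "y \<noteq> pt N" using *[OF N] by auto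
  let ?f = "\<lambda>z \<in> ground M. if z = x then y else pt N"
  let ?g = "\<lambda>z \<in> ground N. if z = y then x else pt M"
  have "?f \<in> strong_maps M N" "?g \<in> strong_maps N M"
    using two_element_strong_map[OF M(1) x N(1) y] two_element_strong_map[OF N(1) y M(1) x] r by simp_all
  moreover have "compose (ground M) ?g ?f = (\<lambda>z \<in> ground M. z)"
    "compose (ground N) ?f ?g = (\<lambda>z \<in> ground N. z)"
    using x y by (auto simp: compose_def fun_eq_iff)
  ultimately have "is_isomorphism Mat M N ?f" by (auto simp: is_isomorphism_def)
  then show ?thesis using Mat.iso_class_eq M N by simp
qed

lemma rank_two_element_restriction:
  assumes M: "pointed_matroid M" and x: "x \<in> ground M"
  shows "rank (restriction M {pt M, x}) = (if x \<in> cl M {} then 0 else 1)"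
proof -
  interpret pointed M by standard fact
  show ?thesis
    using rank_of_restriction[OF M, of "{pt M, x}"] rank_of_insert_pt[OF M, of "{x}"]
      rank_of_insert[of "{}" x] x pt_ground by (simp add: rank_def)
qed

text \<open>\<open>U\<close> is the direct sum of a loop \<open>x\<close> and a coloop
  \<open>y\<close>. Splitting off \<open>x\<close> or \<open>y\<close> first produces the two
  summands in either order, which makes their classes commute. The infinite type supplies three
  elements.\<close>

lemma loop_coloop_sum:
  assumes "infinite (UNIV :: 'a set)"
  obtains U :: "'a pmatroid" and x y where "pointed_matroid U" "ground U = {pt U, x, y}"
    "x \<noteq> pt U" "y \<noteq> pt U" "x \<noteq> y"
    "rank (restriction U {pt U, x}) = 0" "rank (contraction U {x}) = 1"
    "rank (restriction U {pt U, y}) = 1" "rank (contraction U {y}) = 0"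
proof -
  obtain T :: "'a set" where T: "card T = 3" using infinite_arbitrarily_large[OF assms] by blast
  then obtain p x y where "T = {p, x, y}" and d: "x \<noteq> p" "y \<noteq> p" "x \<noteq> y"
    unfolding card_3_iff by metis
  \<comment> \<open>Every closure adjoins the two loops \<open>p\<close> and \<open>x\<close>; only
    \<open>y\<close> carries rank.\<close>
  define U where "U = \<lparr>ground = {p, x, y}, cl = (\<lambda>X \<in> Pow {p, x, y}. insert p (insert x X)), pt = p\<rparr>"
  have [simp]: "ground U = {p, x, y}" "pt U = p"
    and c: "X \<subseteq> {p, x, y} \<Longrightarrow> cl U X = insert p (insert x X)" for X
    by (simp_all add: U_def)
  have "matroid (ground U) (cl U)"
  proof (rule matroidI)
    show "cl U \<in> extensional (Pow (ground U))" by (simp add: U_def)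
  qed (auto simp: c)
  then have U: "pointed_matroid U" using d by (auto simp: pointed_matroid_def c)
  then interpret pointed U by unfold_locales
  have rx: "rank (restriction U {p, x}) = 0" and ry: "rank (restriction U {p, y}) = 1"
    using rank_two_element_restriction[OF U, of x] rank_two_element_restriction[OF U, of y] d
    by (simp_all add: c)
  \<comment> \<open>Once \<open>U\<close> is known to have rank 1, additivity determines the ranks
    of both contractions.\<close>
  have "rank_of U {p, x} = 0"
    using rank_of_restriction[OF U, of "{p, x}"] rx by (simp add: rank_def)
  then have "rank U = 1"
    using rank_of_insert[of "{p, x}" y] d by (simp add: rank_def c insert_commute)
  then have "rank (contraction U {x}) = 1" "rank (contraction U {y}) = 0"
    using rank_nullity_additive(1)[OF U, of "{x}"] rank_nullity_additive(1)[OF U, of "{y}"] rx ry d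
    by simp_all
  then show ?thesis using that[of U x y] U d rx ry by simp
qed


section \<open>Homomorphisms out of free groups\<close>

text \<open>On reduced words this is the homomorphism to the integers that extends \<open>v\<close>
  from the generators.\<close>

definition letter_sum :: "('x \<Rightarrow> int) \<Rightarrow> ('x \<times> bool) list \<Rightarrow> int" where
  "letter_sum v w = (\<Sum>a\<leftarrow>w. if snd a then v (fst a) else - v (fst a))"

text \<open>Letters that cancel contribute opposite values.\<close>

lemma letter_sum_push: "letter_sum v (push_letter a w) = letter_sum v [a] + letter_sum v w"
  by (cases w) (auto simp: letter_sum_def inv_letter_def)

lemma letter_sum_foldr: "letter_sum v (foldr push_letter u w) = letter_sum v u + letter_sum v w"
  by (induction u) (simp_all add: letter_sum_push, simp_all add: letter_sum_def)

lemma letter_sum_free_gen [simp]: "letter_sum v (free_gen x) = v x"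
  by (simp add: letter_sum_def free_gen_def)

lemma letter_sum_hom:
  "(\<lambda>w. (letter_sum v w, letter_sum v' w)) \<in> hom (free_group X) (integer_group \<times>\<times> integer_group)"
  by (rule homI) (simp_all add: free_group_def letter_sum_foldr DirProd_def integer_group_def)

text \<open>A reduced word is the product of its letters, each a generator or the inverse of
  one.\<close>

lemma free_group_hom_eq:
  assumes G: "group G" and f: "f \<in> hom (free_group X) G" and g: "g \<in> hom (free_group X) G"
    and gen: "\<And>x. x \<in> X \<Longrightarrow> f (free_gen x) = g (free_gen x)"
    and w: "w \<in> carrier (free_group X)"
  shows "f w = g w"
proof -
  let ?F = "free_group X"
  interpret F: group ?F by (rule group_free_group)
  interpret G: group G by fact
  interpret f: group_hom ?F G f by unfold_locales fact
  interpret g: group_hom ?F G g by unfold_locales fact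
  have letter: "f [a] = g [a]" if a: "fst a \<in> X" for a
  proof (cases a)
    case (Pair x b)
    have x: "free_gen x \<in> carrier ?F" using a Pair by (simp add: free_gen_in_carrier)
    have "[(x, False)] \<in> carrier ?F" using a Pair by (simp add: free_group_def reduced_def)
    moreover have "[(x, False)] \<otimes>\<^bsub>?F\<^esub> free_gen x = \<one>\<^bsub>?F\<^esub>"
      by (simp add: free_group_def free_gen_def inv_letter_def)
    ultimately have "[(x, False)] = inv\<^bsub>?F\<^esub> free_gen x"
      using F.inv_equality[of "[(x, False)]" "free_gen x"] x by simp
    then show ?thesis using Pair gen[of x] a x f.hom_inv[OF x] g.hom_inv[OF x]
      by (cases b) (simp_all add: free_gen_def)
  qed
  show ?thesis
    using w
  proof (induction w)
    case Nil
    show ?case using f.hom_one g.hom_one by (simp add: free_group_def)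
  next
    case (Cons a w)
    have aw: "[a] \<in> carrier ?F" "w \<in> carrier ?F"
      using Cons.prems reduced_tl[of a w] by (auto simp: free_group_def reduced_def)
    have "[a] \<otimes>\<^bsub>?F\<^esub> w = a # w"
      using Cons.prems by (cases w) (auto simp: free_group_def reduced_def)
    moreover have "f [a] = g [a]" using Cons.prems by (intro letter) (auto simp: free_group_def)
    ultimately show ?case
      using f.hom_mult[OF aw] g.hom_mult[OF aw] Cons.IH[OF aw(2)] by simp
  qed
qed

lemma (in group) int_pow_commute:
  assumes x: "x \<in> carrier G" and y: "y \<in> carrier G" and xy: "x \<otimes> y = y \<otimes> x"
  shows "x [^] (n :: int) \<otimes> y = y \<otimes> x [^] n"
proof -
  have nat: "x [^] k \<otimes> y = y \<otimes> x [^] k" for k :: nat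
    using group_commutes_pow[OF xy x y] .
  have inv: "inv (x [^] k) \<otimes> y = y \<otimes> inv (x [^] k)" for k :: nat
    using nat[of k] x y by (metis inv_closed inv_solve_left inv_solve_right m_assoc m_closed nat_pow_closed)
  show ?thesis by (cases "n < 0") (simp_all only: int_pow_def2 if_True if_False nat inv)
qed

text \<open>The group is not assumed abelian, since for \<open>K0 Mat\<close> only the commutation
  of two classes is at hand. The map both gathers powers along exact sequences and leads from \<int>
  \<oplus> \<int> back to \<open>K0 Mat\<close>.\<close>

lemma (in group) int_pow_pair_hom:
  assumes x: "x \<in> carrier G" and y: "y \<in> carrier G" and xy: "x \<otimes> y = y \<otimes> x"
  shows "(\<lambda>(m, n). x [^] m \<otimes> y [^] n) \<in> hom (integer_group \<times>\<times> integer_group) G"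
proof (rule homI)
  fix a b
  assume "a \<in> carrier (integer_group \<times>\<times> integer_group)" "b \<in> carrier (integer_group \<times>\<times> integer_group)"
  obtain m n m' n' where ab: "a = (m, n)" "b = (m', n')" by (cases a; cases b)
  have c: "y [^] n \<otimes> x [^] m' = x [^] m' \<otimes> y [^] n"
    using int_pow_commute[of y "x [^] m'" n] int_pow_commute[OF x y xy, of m'] x y by simp
  have "x [^] (m + m') \<otimes> y [^] (n + n') = x [^] m \<otimes> (x [^] m' \<otimes> y [^] n) \<otimes> y [^] n'"
    using x y by (simp add: int_pow_mult m_assoc)
  also have "\<dots> = x [^] m \<otimes> (y [^] n \<otimes> x [^] m') \<otimes> y [^] n'"
    by (simp only: c)
  also have "\<dots> = (x [^] m \<otimes> y [^] n) \<otimes> (x [^] m' \<otimes> y [^] n')"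
    using x y by (simp add: m_assoc)
  finally show "(case a \<otimes>\<^bsub>integer_group \<times>\<times> integer_group\<^esub> b of (m, n) \<Rightarrow> x [^] m \<otimes> y [^] n) =
      (case a of (m, n) \<Rightarrow> x [^] m \<otimes> y [^] n) \<otimes> (case b of (m, n) \<Rightarrow> x [^] m \<otimes> y [^] n)"
    by (simp add: ab DirProd_def integer_group_def)
qed (use x y in auto)

lemma (in group) normal_closure_subset: "\<lbrakk>N \<lhd> G; R \<subseteq> N\<rbrakk> \<Longrightarrow> normal_closure G R \<subseteq> N"
  by (auto simp: normal_closure_def)


section \<open>Classes in the Grothendieck group\<close>

definition K0_proj :: "('o, 'm, 'z) proto_exact_data_scheme \<Rightarrow> ('o set \<times> bool) list \<Rightarrow> ('o set \<times> bool) list set" where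
  "K0_proj C w = normal_closure (free_group (Iso_classes C)) (K0_relators C) #>\<^bsub>free_group (Iso_classes C)\<^esub> w"

definition K0_class :: "('o, 'm, 'z) proto_exact_data_scheme \<Rightarrow> 'o \<Rightarrow> ('o set \<times> bool) list set" where
  "K0_class C X = K0_proj C (free_gen (iso_class C X))"

lemma normal_K0:
  "normal_closure (free_group (Iso_classes C)) (K0_relators C) \<lhd> free_group (Iso_classes C)"
  "K0_relators C \<subseteq> normal_closure (free_group (Iso_classes C)) (K0_relators C)"
  using group.normal_closure_normal[OF group_free_group K0_relators_subset] .

lemma K0_proj_hom: "K0_proj C \<in> hom (free_group (Iso_classes C)) (K0 C)"
  using normal.r_coset_hom_Mod[OF normal_K0(1)]
  by (simp add: K0_def Let_def K0_proj_def[abs_def])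

lemma K0_class_closed: "X \<in> Obj C \<Longrightarrow> K0_class C X \<in> carrier (K0 C)"
  unfolding K0_class_def
  by (rule hom_in_carrier[OF K0_proj_hom]) (simp add: free_gen_in_carrier iso_class_in)

text \<open>The relator lies in the normal subgroup that is divided out, so both sides are the same
  coset.\<close>

lemma K0_class_ses:
  assumes "admissible_ses C A B D i q"
  shows "K0_class C B = K0_class C A \<otimes>\<^bsub>K0 C\<^esub> K0_class C D"
proof -
  let ?F = "free_group (Iso_classes C)" and ?g = "\<lambda>X. free_gen (iso_class C X)"
  let ?N = "normal_closure ?F (K0_relators C)"
  interpret F: group ?F by (rule group_free_group)
  have g: "?g A \<in> carrier ?F" "?g B \<in> carrier ?F" "?g D \<in> carrier ?F"
    using admissible_ses_Obj[OF assms] by (simp_all add: free_gen_in_carrier iso_class_in)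
  have N: "subgroup ?N ?F" using normal_K0(1) by (rule normal_imp_subgroup)
  let ?r = "?g B \<otimes>\<^bsub>?F\<^esub> inv\<^bsub>?F\<^esub> (?g A \<otimes>\<^bsub>?F\<^esub> ?g D)"
  have "?r \<in> K0_relators C" using assms unfolding K0_relators_def Let_def by blast
  then have "?r \<in> ?N" using normal_K0(2) by blast
  then have "?r \<otimes>\<^bsub>?F\<^esub> (?g A \<otimes>\<^bsub>?F\<^esub> ?g D) \<in> ?N #>\<^bsub>?F\<^esub> (?g A \<otimes>\<^bsub>?F\<^esub> ?g D)"
    using F.rcosI[of ?r ?N] subgroup.subset[OF N] g by simp
  moreover have "?r \<otimes>\<^bsub>?F\<^esub> (?g A \<otimes>\<^bsub>?F\<^esub> ?g D) = ?g B" using g by (simp add: F.m_assoc)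
  ultimately have "K0_proj C (?g A \<otimes>\<^bsub>?F\<^esub> ?g D) = K0_proj C (?g B)"
    using F.repr_independence[OF _ _ N] g by (simp add: K0_proj_def)
  then show ?thesis
    using hom_mult[OF K0_proj_hom[of C]] g by (simp add: K0_class_def)
qed

lemma K0_class_restriction_contraction:
  assumes "pointed_matroid M" "S \<subseteq> ground M" "pt M \<notin> S"
  shows "K0_class Mat M =
    K0_class Mat (restriction M (insert (pt M) S)) \<otimes>\<^bsub>K0 Mat\<^esub> K0_class Mat (contraction M S)"
  by (rule K0_class_ses[OF admissible_ses_restriction_contraction[OF assms]])

text \<open>With \<open>S\<close> empty, restriction and contraction both return \<open>M\<close>,
  so its class is idempotent, hence the identity.\<close>

lemma K0_class_singleton:
  assumes M: "pointed_matroid M" and g: "ground M = {pt M}"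
  shows "K0_class Mat M = \<one>\<^bsub>K0 Mat\<^esub>"
proof -
  interpret K: group "K0 Mat" by (rule group_K0)
  have R: "pointed_matroid (restriction M {pt M})"
    using pointed_matroid_restriction[OF M] g by simp
  have C: "pointed_matroid (contraction M {})"
    using pointed_matroid_contraction[OF M] by simp
  have "restriction M {pt M} = M" "contraction M {} = M"
    using g singleton_pmatroid[OF M g] singleton_pmatroid[OF R] singleton_pmatroid[OF C]
    by (auto intro!: pmatroid_eqI[OF R M] pmatroid_eqI[OF C M])
  then have "K0_class Mat M = K0_class Mat M \<otimes>\<^bsub>K0 Mat\<^esub> K0_class Mat M"
    using K0_class_restriction_contraction[OF M, of "{}"] by simp
  moreover have "K0_class Mat M \<in> carrier (K0 Mat)" using M by (simp add: K0_class_closed)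
  ultimately show ?thesis using K.r_cancel_one' by metis
qed

lemma K0_class_two_element:
  "\<lbrakk>pointed_matroid M; card (ground M) = 2; pointed_matroid N; card (ground N) = 2; rank M = rank N\<rbrakk>
    \<Longrightarrow> K0_class Mat M = K0_class Mat N"
  unfolding K0_class_def by (simp add: two_element_iso_class[of M N])

text \<open>Induction on the size of the ground set: an element other than the point splits
  \<open>M\<close> into a two-element restriction and a contraction with one element fewer.
  Exponents add by \<open>rank_nullity_additive\<close>, and powers can be gathered by
  \<open>comm\<close>.\<close>

lemma K0_class_rank_nullity:
  fixes L C M :: "'a pmatroid"
  assumes L: "pointed_matroid L" "card (ground L) = 2" "rank L = 0"
    and C: "pointed_matroid C" "card (ground C) = 2" "rank C = 1"
    and comm: "K0_class Mat L \<otimes>\<^bsub>K0 Mat\<^esub> K0_class Mat C = K0_class Mat C \<otimes>\<^bsub>K0 Mat\<^esub> K0_class Mat L"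
    and M: "pointed_matroid M"
  shows "K0_class Mat M =
    K0_class Mat L [^]\<^bsub>K0 Mat\<^esub> nullity M \<otimes>\<^bsub>K0 Mat\<^esub> K0_class Mat C [^]\<^bsub>K0 Mat\<^esub> rank M"
  using M
proof (induction "card (ground M)" arbitrary: M rule: less_induct)
  case less
  interpret K: group "K0 Mat" by (rule group_K0)
  interpret pointed M by standard (rule less.prems)
  note M = less.prems
  let ?l = "K0_class Mat L" and ?c = "K0_class Mat C"
  have lc: "?l \<in> carrier (K0 Mat)" "?c \<in> carrier (K0 Mat)"
    using L C by (simp_all add: K0_class_closed)
  show ?case
  \<comment> \<open>Two elements belong to the base case: there the restriction to the point and
    \<open>x\<close> is no smaller than \<open>M\<close>.\<close>
  proof (cases "card (ground M) \<le> 2")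
    case True
    show ?thesis
    proof (cases "ground M = {pt M}")
      case gM: True
      have "rank M = 0" using rank_of_insert_pt[OF M, of "{}"] gM by (simp add: rank_def)
      then show ?thesis using K0_class_singleton[OF M gM] gM by (simp add: nullity_def)
    next
      case False
      then obtain x where x: "x \<in> ground M" "x \<noteq> pt M" using pt_ground by auto
      then have gM: "ground M = {pt M, x}"
        using True pt_ground fin card_seteq[of "ground M" "{pt M, x}"] by auto
      then have c2: "card (ground M) = 2" using x by simp
      consider "rank M = 0" | "rank M = 1" using flats_two_element(2)[OF M gM x(2)] by auto
      then show ?thesis
      proof cases
        case 1
        then show ?thesis using K0_class_two_element[OF M c2 L(1,2)] L(3) c2 lc
          by (simp add: nullity_def)
      next
        case 2
        then show ?thesis using K0_class_two_element[OF M c2 C(1,2)] C(3) c2 lc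
          by (simp add: nullity_def)
      qed
    qed
  next
    case False
    then have "\<not> ground M \<subseteq> {pt M}" using card_mono[of "{pt M}" "ground M"] by auto
    then obtain x where x: "x \<in> ground M" "x \<noteq> pt M" by auto
    have S: "{x} \<subseteq> ground M" "pt M \<notin> {x}" using x by auto
    let ?A = "restriction M {pt M, x}" and ?D = "contraction M {x}"
    have A: "pointed_matroid ?A" using pointed_matroid_restriction[OF M, of "{pt M, x}"] x pt_ground by simp
    have D: "pointed_matroid ?D" by (rule pointed_matroid_contraction[OF M S])
    have "card (ground ?A) < card (ground M)" "card (ground ?D) < card (ground M)"
      using False x fin card_Diff1_less[OF fin x(1)] by (auto simp: card_insert_if)
    then have IH: "K0_class Mat ?A = ?l [^]\<^bsub>K0 Mat\<^esub> nullity ?A \<otimes>\<^bsub>K0 Mat\<^esub> ?c [^]\<^bsub>K0 Mat\<^esub> rank ?A"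
      "K0_class Mat ?D = ?l [^]\<^bsub>K0 Mat\<^esub> nullity ?D \<otimes>\<^bsub>K0 Mat\<^esub> ?c [^]\<^bsub>K0 Mat\<^esub> rank ?D"
      using less.hyps[OF _ A] less.hyps[OF _ D] by simp_all
    have "K0_class Mat M = K0_class Mat ?A \<otimes>\<^bsub>K0 Mat\<^esub> K0_class Mat ?D"
      using K0_class_restriction_contraction[OF M S] by simp
    moreover have "rank M = rank ?A + rank ?D" "nullity M = nullity ?A + nullity ?D"
      using rank_nullity_additive[OF M S] by simp_all
    ultimately show ?thesis
      using hom_mult[OF K.int_pow_pair_hom[OF lc comm], of "(nullity ?A, rank ?A)" "(nullity ?D, rank ?D)"] IH
      by (simp add: DirProd_def integer_group_def)
  qed
qed

text \<open>The free generators are isomorphism classes, so the invariant is read off a chosen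
  member; \<open>rank_nullity_isomorphic\<close> makes the choice immaterial.\<close>

definition class_rank :: "'a pmatroid set \<Rightarrow> int" where
  "class_rank c = rank (SOME M. M \<in> c)"

definition class_nullity :: "'a pmatroid set \<Rightarrow> int" where
  "class_nullity c = nullity (SOME M. M \<in> c)"

lemma class_rank_nullity [simp]:
  assumes M: "pointed_matroid M"
  shows "class_rank (iso_class Mat M) = rank M" "class_nullity (iso_class Mat M) = nullity M"
proof -
  have "(SOME N. N \<in> iso_class Mat M) \<in> iso_class Mat M"
    using Mat.iso_class_self[of M] M by (intro someI) simp
  then obtain f where "pointed_matroid (SOME N. N \<in> iso_class Mat M)"
    "is_isomorphism Mat M (SOME N. N \<in> iso_class Mat M) f"
    by (auto simp: iso_class_def iso_rel_def)
  then show "class_rank (iso_class Mat M) = rank M" "class_nullity (iso_class Mat M) = nullity M"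
    using rank_nullity_isomorphic[OF M] by (simp_all add: class_rank_def class_nullity_def)
qed

section \<open>The isomorphism with \<int> \<oplus> \<int>\<close>

theorem theoremB:
  assumes "infinite (UNIV :: 'a set)"
  shows "K0 (Mat :: ('a pmatroid, 'a \<Rightarrow> 'a) proto_exact_data) \<cong> integer_group \<times>\<times> integer_group"
proof -
  let ?Mat = "Mat :: ('a pmatroid, 'a \<Rightarrow> 'a) proto_exact_data"
  let ?F = "free_group (Iso_classes ?Mat)" and ?Z = "integer_group \<times>\<times> integer_group"
  let ?N = "normal_closure ?F (K0_relators ?Mat)"
  \<comment> \<open>Nullity comes first, so a loop is sent to \<open>(1, 0)\<close> and a coloop to
    \<open>(0, 1)\<close>.\<close>
  define h :: "('a pmatroid set \<times> bool) list \<Rightarrow> int \<times> int"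
    where "h = (\<lambda>w. (letter_sum class_nullity w, letter_sum class_rank w))"
  interpret F: group ?F by (rule group_free_group)
  interpret K: group "K0 ?Mat" by (rule group_K0)
  interpret Z: group ?Z by (intro DirProd_group) simp_all
  have hh: "h \<in> hom ?F ?Z" unfolding h_def by (rule letter_sum_hom)
  then interpret h: group_hom ?F ?Z h by unfold_locales
  have h_gen: "h (free_gen (iso_class Mat M)) = (nullity M, rank M)"
    if "pointed_matroid M" for M :: "'a pmatroid"
    using that by (simp add: h_def)
  have gen_closed: "free_gen (iso_class Mat M) \<in> carrier ?F"
    if "pointed_matroid M" for M :: "'a pmatroid"
    using that by (simp add: free_gen_in_carrier iso_class_in)

  obtain U :: "'a pmatroid" and x y where U: "pointed_matroid U" "ground U = {pt U, x, y}"
    "x \<noteq> pt U" "y \<noteq> pt U" "x \<noteq> y"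
    and r: "rank (restriction U {pt U, x}) = 0" "rank (contraction U {x}) = 1"
      "rank (restriction U {pt U, y}) = 1" "rank (contraction U {y}) = 0"
    using loop_coloop_sum[OF assms] .
  \<comment> \<open>The contractions of \<open>U\<close> agree with these restrictions only up to
    isomorphism, which rank decides for two elements.\<close>
  define L C where "L = restriction U {pt U, x}" and "C = restriction U {pt U, y}"
  have L: "pointed_matroid L" "card (ground L) = 2" "rank L = 0"
    and C: "pointed_matroid C" "card (ground C) = 2" "rank C = 1"
    using U r pointed_matroid_restriction[OF U(1)] by (simp_all add: L_def C_def)
  have gr: "{pt U, x, y} - {x} = {pt U, y}" "{pt U, x, y} - {y} = {pt U, x}" using U by auto
  have "pointed_matroid (contraction U {x})" "pointed_matroid (contraction U {y})"
    using pointed_matroid_contraction[OF U(1)] U by simp_all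
  moreover have "card (ground (contraction U {x})) = 2" "card (ground (contraction U {y})) = 2"
    using U(3-5) by (simp_all add: U(2) gr)
  ultimately have "K0_class ?Mat (contraction U {x}) = K0_class ?Mat C"
    "K0_class ?Mat (contraction U {y}) = K0_class ?Mat L"
    using K0_class_two_element[of "contraction U {x}" C]
      K0_class_two_element[of "contraction U {y}" L] r L C by simp_all
  \<comment> \<open>Both products are the class of \<open>U\<close>, split at \<open>x\<close> and
    at \<open>y\<close>.\<close>
  then have comm: "K0_class ?Mat L \<otimes>\<^bsub>K0 Mat\<^esub> K0_class ?Mat C = K0_class ?Mat C \<otimes>\<^bsub>K0 Mat\<^esub> K0_class ?Mat L"
    using K0_class_restriction_contraction[OF U(1), of "{x}"]
      K0_class_restriction_contraction[OF U(1), of "{y}"] U by (simp add: L_def C_def)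
  have lc: "K0_class ?Mat L \<in> carrier (K0 ?Mat)" "K0_class ?Mat C \<in> carrier (K0 ?Mat)"
    using L C by (simp_all add: K0_class_closed)
  \<comment> \<open>This will invert the map that \<open>h\<close> induces on the quotient.\<close>
  define e where "e = (\<lambda>(m, n). K0_class ?Mat L [^]\<^bsub>K0 ?Mat\<^esub> (m :: int) \<otimes>\<^bsub>K0 ?Mat\<^esub> K0_class ?Mat C [^]\<^bsub>K0 ?Mat\<^esub> (n :: int))"
  have eh: "e \<in> hom ?Z (K0 ?Mat)" unfolding e_def by (rule K.int_pow_pair_hom[OF lc comm])

  \<comment> \<open>On generators this is \<open>K0_class_rank_nullity\<close>. It shows that the
    kernel of \<open>h\<close> is no larger than \<open>?N\<close>.\<close>
  have proj: "K0_proj ?Mat w = (e \<circ> h) w" if "w \<in> carrier ?F" for w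
  proof (rule free_group_hom_eq[OF K.is_group K0_proj_hom _ _ that])
    show "e \<circ> h \<in> hom ?F (K0 ?Mat)" using hom_compose[OF hh eh] .
    fix c assume "c \<in> Iso_classes ?Mat"
    then obtain M where M: "pointed_matroid M" "c = iso_class Mat M"
      by (auto simp: Iso_classes_def iso_class_def elim: quotientE)
    then show "K0_proj ?Mat (free_gen c) = (e \<circ> h) (free_gen c)"
      using K0_class_rank_nullity[OF L C comm M(1)] h_gen[OF M(1)] by (simp add: K0_class_def e_def)
  qed

  \<comment> \<open>Relators die under \<open>h\<close> by additivity of rank and nullity; hence
    \<open>h\<close> is trivial on \<open>?N\<close>.\<close>
  have "h w = \<one>\<^bsub>?Z\<^esub>" if w: "w \<in> K0_relators ?Mat" for w
  proof -
    obtain A B D i q where s: "admissible_ses ?Mat A B D i q"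
      and w_eq: "w = free_gen (iso_class Mat B) \<otimes>\<^bsub>?F\<^esub>
        inv\<^bsub>?F\<^esub> (free_gen (iso_class Mat A) \<otimes>\<^bsub>?F\<^esub> free_gen (iso_class Mat D))"
      using w unfolding K0_relators_def Let_def by blast
    have pm: "pointed_matroid A" "pointed_matroid B" "pointed_matroid D"
      using admissible_ses_Obj[OF s] by auto
    have "h (free_gen (iso_class Mat B)) =
        h (free_gen (iso_class Mat A) \<otimes>\<^bsub>?F\<^esub> free_gen (iso_class Mat D))"
      using h.hom_mult gen_closed pm h_gen rank_nullity_ses[OF s]
      by (simp add: DirProd_def integer_group_def)
    then show ?thesis using w_eq gen_closed pm by (simp add: h.hom_mult h.hom_inv)
  qed
  then have "K0_relators ?Mat \<subseteq> kernel ?F ?Z h"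
    using K0_relators_subset[of ?Mat] by (auto simp: kernel_def)
  then have "?N \<subseteq> kernel ?F ?Z h"
    by (intro F.normal_closure_subset h.normal_kernel)
  \<comment> \<open>The projection factors through \<open>h\<close>, so it sends \<open>w\<close> to
    the identity coset \<open>?N\<close>.\<close>
  moreover have "w \<in> ?N" if "w \<in> kernel ?F ?Z h" for w
  proof -
    have w: "w \<in> carrier ?F" "h w = \<one>\<^bsub>?Z\<^esub>" using that by (auto simp: kernel_def)
    have "K0_proj ?Mat w = \<one>\<^bsub>K0 ?Mat\<^esub>"
      using proj[OF w(1)] w(2) hom_one[OF eh Z.is_group K.is_group] by simp
    then have "?N #>\<^bsub>?F\<^esub> w = ?N" by (simp add: K0_proj_def K0_def Let_def FactGroup_def)
    then show ?thesis
      using F.coset_join1[OF _ w(1) normal_imp_subgroup[OF normal_K0(1)]] by simp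
  qed
  ultimately have ker: "kernel ?F ?Z h = ?N" by auto

  \<comment> \<open>Surjectivity: the preimage is the product of the powers \<open>m\<close> and
    \<open>n\<close> of the loop and coloop generators.\<close>
  have "(m, n) \<in> h ` carrier ?F" for m n
  proof -
    let ?l = "free_gen (iso_class Mat L)" and ?c = "free_gen (iso_class Mat C)"
    have g: "?l \<in> carrier ?F" "?c \<in> carrier ?F" using gen_closed L C by simp_all
    have Z_mult: "(a, b) \<otimes>\<^bsub>?Z\<^esub> (a', b') = (a + a', b + b')" for a b a' b'
      by (simp add: DirProd_def integer_group_def)
    have pow: "(a, b) [^]\<^bsub>?Z\<^esub> (k :: int) = (k * a, k * b)" for a b k
    proof (induction k rule: int_induct[where k = 0])
      case base
      then show ?case by (simp add: DirProd_def integer_group_def)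
    next
      case (step1 i)
      have "(a, b) [^]\<^bsub>?Z\<^esub> (i + 1) = (a, b) [^]\<^bsub>?Z\<^esub> i \<otimes>\<^bsub>?Z\<^esub> (a, b)"
        by (simp add: Z.int_pow_mult)
      then show ?case using step1 by (simp add: Z_mult algebra_simps)
    next
      case (step2 i)
      \<comment> \<open>The power at \<open>i - 1\<close> is recovered from the known one at
        \<open>i\<close> by solving this equation in each component.\<close>
      have "(a, b) [^]\<^bsub>?Z\<^esub> (i - 1 + 1) = (a, b) [^]\<^bsub>?Z\<^esub> (i - 1) \<otimes>\<^bsub>?Z\<^esub> (a, b)"
        by (subst Z.int_pow_mult) simp_all
      then show ?case using step2
        by (cases "(a, b) [^]\<^bsub>?Z\<^esub> (i - 1)") (auto simp: Z_mult algebra_simps)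
    qed
    have "h ?l = (1, 0)" "h ?c = (0, 1)"
      using h_gen[OF L(1)] h_gen[OF C(1)] L C by (simp_all add: nullity_def)
    then have "h (?l [^]\<^bsub>?F\<^esub> m \<otimes>\<^bsub>?F\<^esub> ?c [^]\<^bsub>?F\<^esub> n) = (m, n)"
      using g by (simp add: h.hom_mult h.hom_int_pow pow)
    then show ?thesis using g by (metis F.int_pow_closed F.m_closed imageI)
  qed
  then have "h ` carrier ?F = carrier ?Z" using h.hom_closed by (auto simp: DirProd_def integer_group_def)
  \<comment> \<open>First isomorphism theorem; the quotient is \<open>K0 Mat\<close> because the
    kernel is \<open>?N\<close>.\<close>
  then have "?F Mod kernel ?F ?Z h \<cong> ?Z" by (rule h.FactGroup_iso)
  then show ?thesis by (simp add: ker K0_def Let_def)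
qed

end
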